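(* Let $(Q,L,f)$ be a regular forced mechanical system, $Q_0\subset Q$ a relatively compact open subset, $(Q,\psi^E,L^E_\cdot,f^E_\cdot)$ an exact discretization of $(Q,L,f)$, and let $\mathcal U^E$, $a>0$, $\mathcal V_h$ and the forced discrete mechanical systems $\Sigma_h^E=(Q_0,\mathcal V_h,L^E_h|_{\mathcal V_h},f^E_h|_{\mathcal V_h})$, $0\neq|h|<a$, be as in the context. Then there is an open neighborhood $\tilde U\subset\mathbb R\times TQ\times TQ$ of $\{0\}\times\Delta_{TQ_0}$, where $\Delta_{TQ_0}=\{(v,v):v\in TQ_0\}$, such that for all $(h,v,\tilde v)\in\tilde U$ with $0\ne|h|<a$ the following are equivalent: (1) $\tilde v=F^{X_{L,f}}_h(v)$; (2) $(v,\tilde v)$ is a trajectory of $\Sigma^E_h$.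
   Context: A forced mechanical system (FMS) is a triple $(Q,L,f)$ with $Q$ a finite-dimensional smooth manifold, $L:TQ\to\mathbb R$ smooth and $f$ a smooth horizontal $1$-form on $TQ$ (it vanishes on $\ker T\tau_Q$, $\tau_Q:TQ\to Q$; in local coordinates $f=f_i(q,\dot q)\,dq^i$). Its trajectories are the curves $q(t)$ satisfying the forced Euler–Lagrange equations $\frac{d}{dt}\frac{\partial L}{\partial\dot q^i}-\frac{\partial L}{\partial q^i}=f_i$. It is regular if the Legendre transform $\mathbb FL:TQ\to T^*Q$, $\mathbb FL(v_q)(w_q)=\frac{d}{dt}|_{t=0}L(v_q+tw_q)$, is a local diffeomorphism; then there is a unique second-order vector field $X_{L,f}$ on $TQ$ whose integral curves are the velocities of the trajectories. Its flow is $F^{X_{L,f}}:U^{X_{L,f}}\to TQ$, $(t,v)\mapsto F^{X_{L,f}}_t(v)$, with $U^{X_{L,f}}\subset\mathbb R\times TQ$ open, containing $\{0\}\times TQ$, for each $v$ an interval in $t$ symmetric about $0$. Let $\alpha^\pm:(-a_0,a_0)\to\mathbb R$ be smooth ($a_0>0$) with $h\alpha^+(h)\ge0$, $h\alpha^-(h)\le0$, $\alpha^+(h)-\alpha^-(h)=h$. The exact discretization of $(Q,L,f)$ associated with $\alpha^{\pm}$ is $(Q,\psi^E,L^E_\cdot,f^E_\cdot)$, where $\psi^E(h,t,v)=\tau_Q(F_t^{X_{L,f}}(v))$, and for $(h,v)\in U^{X_{L,f}}$ (with $|h|<a_0$), $\delta v\in T_vTQ$: $L^E_h(v)=\int_{\alpha^-(h)}^{\alpha^+(h)}L(F_t^{X_{L,f}}(v))\,dt$,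 $f_h^E(v)(\delta v)=\int_{\alpha^-(h)}^{\alpha^+(h)}f(F^{X_{L,f}}_t(v))(T_vF_t^{X_{L,f}}(\delta v))\,dt$. The boundary maps are $\partial_h^{E\pm}(v)=\tau_Q(F^{X_{L,f}}_{\alpha^\pm(h)}(v))$; put $\partial^{E\mp}_h(v)=(\partial_h^{E-}(v),\partial_h^{E+}(v))$ and $\tilde\partial^{E\mp}(h,v)=(h,\partial_h^{E\mp}(v))$. Fix an open set $\mathcal U^E\subset U^{X_{L,f}}$ containing $\{0\}\times TQ$, contained in the domain of $\tilde\partial^{E\mp}$, such that, with $\mathcal W^E:=\tilde\partial^{E\mp}(\mathcal U^E)\supset\{0\}\times\Delta_Q$ ($\Delta_Q$ the diagonal of $Q\times Q$), $\tilde\partial^{E\mp}$ is a diffeomorphism from $\mathcal U^E\setminus(\{0\}\times TQ)$ onto the open set $\mathcal W^E\setminus(\{0\}\times Q\times Q)$ (such $\mathcal U^E$ exists). Let $\mathcal V_h:=\{v\in TQ:(h,v)\in\mathcal U^E,\ \partial_h^{E\mp}(v)\in Q_0\times Q_0\}$, and let $a>0$ be such that $(-a,a)\times\Delta_{Q_0}\subset\mathcal W^E$ (such $a$ exists). For $0\ne|h|<a$, $(\mathcal V_h,\partial_h^{E+},\partial_h^{E-})$ is a discrete tangent bundle of $Q_0$ and $\Sigma_h^E=(Q_0,\mathcal V_h,L_h^E|_{\mathcal V_h},f_h^E|_{\mathcal V_h})$ is a forced discrete mechanical system. A pair $(v,\tilde v)\in\mathcal V_h\times\mathcal V_h$ is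 a (length 2) trajectory of $\Sigma^E_h$ if $\partial_h^{E+}(v)=\partial_h^{E-}(\tilde v)$ and $(dL^E_h+f_h^E)(v)(\delta v)+(dL^E_h+f_h^E)(\tilde v)(\delta\tilde v)=0$ for all $\delta v\in T_v\mathcal V_h$, $\delta\tilde v\in T_{\tilde v}\mathcal V_h$ with $T_v\partial_h^{E-}(\delta v)=0$, $T_v\partial_h^{E+}(\delta v)=T_{\tilde v}\partial_h^{E-}(\delta\tilde v)$, $T_{\tilde v}\partial_h^{E+}(\delta\tilde v)=0$. *)

theory Defs
  imports "HOL-Analysis.Analysis"
begin

section \<open>Smooth maps between normed spaces\<close>

text \<open>
  For an open set \<open>S\<close> in a finite-dimensional space this is the usual notion of a \<open>C\<^sup>k\<close> map:
  the total derivative exists and is continuous, and all its components, i.e.\ all directional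
  derivatives, are again \<open>C\<^sup>k\<^sup>-\<^sup>1\<close>.
\<close>

primrec Ck_on :: "nat \<Rightarrow> 'a::real_normed_vector set \<Rightarrow> ('a \<Rightarrow> 'b::real_normed_vector) \<Rightarrow> bool" where
  "Ck_on 0 S f \<longleftrightarrow> continuous_on S f"
| "Ck_on (Suc k) S f \<longleftrightarrow>
     (\<exists>f' :: 'a \<Rightarrow> 'a \<Rightarrow>\<^sub>L 'b.
        (\<forall>x\<in>S. (f has_derivative blinfun_apply (f' x)) (at x)) \<and>
        continuous_on S f' \<and>
        (\<forall>v. Ck_on k S (\<lambda>x. blinfun_apply (f' x) v)))"

definition smooth_on :: "'a::real_normed_vector set \<Rightarrow> ('a \<Rightarrow> 'b::real_normed_vector) \<Rightarrow> bool" where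
  "smooth_on S f \<longleftrightarrow> (\<forall>k. Ck_on k S f)"


section \<open>Smooth manifolds\<close>

text \<open>
  A manifold is given by an atlas, from which both the underlying set and the topology are
  recovered.  A chart is a pair of a domain and a coordinate map (junk outside the domain);
  the model space \<open>'e\<close> is a finite-dimensional normed space, so every dimension (including 0)
  is covered.  Such spaces are complete, so instantiating \<open>'e\<close> with class \<open>banach\<close> loses nothing.
\<close>

type_synonym ('q, 'e) chart = "'q set \<times> ('q \<Rightarrow> 'e)"
type_synonym ('q, 'e) atlas = "('q, 'e) chart set"

definition chart_inv :: "('q, 'e) chart \<Rightarrow> 'e \<Rightarrow> 'q" where
  "chart_inv c = inv_into (fst c) (snd c)"

definition transition :: "('q, 'e) chart \<Rightarrow> ('q, 'e) chart \<Rightarrow> 'e \<Rightarrow> 'e" where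
  "transition c d = snd d \<circ> chart_inv c"

definition points :: "('q, 'e) atlas \<Rightarrow> 'q set" where
  "points A = (\<Union>c\<in>A. fst c)"

definition manifold_topology :: "('q, 'e::topological_space) atlas \<Rightarrow> 'q topology" where
  "manifold_topology A =
     topology (\<lambda>W. W \<subseteq> points A \<and> (\<forall>c\<in>A. open (snd c ` (W \<inter> fst c))))"

lemma openin_manifold_topology:
  assumes "\<And>c. c \<in> A \<Longrightarrow> inj_on (snd c) (fst c)"
  shows "openin (manifold_topology A) W \<longleftrightarrow>
           W \<subseteq> points A \<and> (\<forall>c\<in>A. open (snd c ` (W \<inter> fst c)))"
proof -
  have "istopology (\<lambda>W. W \<subseteq> points A \<and> (\<forall>c\<in>A. open (snd c ` (W \<inter> fst c))))"
    unfolding istopology_def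
  proof (intro conjI allI impI ballI)
    fix S T c
    assume S: "S \<subseteq> points A \<and> (\<forall>c\<in>A. open (snd c ` (S \<inter> fst c)))"
      and T: "T \<subseteq> points A \<and> (\<forall>c\<in>A. open (snd c ` (T \<inter> fst c)))"
    show "S \<inter> T \<subseteq> points A" using S by blast
    assume c: "c \<in> A"
    have "snd c ` (S \<inter> T \<inter> fst c) = snd c ` (S \<inter> fst c) \<inter> snd c ` (T \<inter> fst c)"
      using inj_on_image_Int[OF assms[OF c], of "S \<inter> fst c" "T \<inter> fst c"]
      by (simp add: Int_ac)
    then show "open (snd c ` (S \<inter> T \<inter> fst c))" using S T c by (simp add: open_Int)
  next
    fix K c
    assume K: "\<forall>W\<in>K. W \<subseteq> points A \<and> (\<forall>c\<in>A. open (snd c ` (W \<inter> fst c)))"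
    show "\<Union>K \<subseteq> points A" using K by blast
    assume c: "c \<in> A"
    have "snd c ` (\<Union>K \<inter> fst c) = (\<Union>W\<in>K. snd c ` (W \<inter> fst c))" by blast
    then show "open (snd c ` (\<Union>K \<inter> fst c))" using K c by (simp add: open_UN)
  qed
  then show ?thesis by (simp add: manifold_topology_def topology_inverse')
qed

definition smooth_manifold :: "('q, 'e::real_normed_vector) atlas \<Rightarrow> bool" where
  "smooth_manifold A \<longleftrightarrow>
     (\<exists>B::'e set. finite B \<and> span B = UNIV) \<and>
     (\<forall>c\<in>A. inj_on (snd c) (fst c) \<and> open (snd c ` fst c)) \<and>
     (\<forall>c\<in>A. \<forall>d\<in>A. open (snd c ` (fst c \<inter> fst d)) \<and>
        smooth_on (snd c ` (fst c \<inter> fst d)) (transition c d)) \<and>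
     Hausdorff_space (manifold_topology A) \<and>
     second_countable (manifold_topology A)"

definition vec_atlas :: "('e, 'e::real_normed_vector) atlas" where
  "vec_atlas = {(UNIV, \<lambda>x. x)}"

definition prod_atlas :: "('p, 'd) atlas \<Rightarrow> ('q, 'e) atlas \<Rightarrow> ('p \<times> 'q, 'd \<times> 'e) atlas" where
  "prod_atlas A B = {(fst c \<times> fst d, map_prod (snd c) (snd d)) | c d. c \<in> A \<and> d \<in> B}"

text \<open>
  Smoothness on \<open>S\<close>.  The openness condition expresses that \<open>S\<close> is open and \<open>F\<close> continuous.
\<close>

definition smooth_map ::
  "('p, 'd::real_normed_vector) atlas \<Rightarrow> ('q, 'e::real_normed_vector) atlas \<Rightarrow> 'p set \<Rightarrow> ('p \<Rightarrow> 'q) \<Rightarrow> bool" where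
  "smooth_map A B S F \<longleftrightarrow>
     S \<subseteq> points A \<and> F ` S \<subseteq> points B \<and>
     (\<forall>c\<in>A. \<forall>d\<in>B.
        let W = snd c ` {p \<in> S \<inter> fst c. F p \<in> fst d}
        in open W \<and> smooth_on W (snd d \<circ> F \<circ> chart_inv c))"

definition diffeo_on ::
  "('p, 'd::real_normed_vector) atlas \<Rightarrow> ('q, 'e::real_normed_vector) atlas \<Rightarrow> 'p set \<Rightarrow> 'q set \<Rightarrow> ('p \<Rightarrow> 'q) \<Rightarrow> bool" where
  "diffeo_on A B S T F \<longleftrightarrow>
     openin (manifold_topology A) S \<and> openin (manifold_topology B) T \<and>
     bij_betw F S T \<and> smooth_map A B S F \<and> smooth_map B A T (inv_into S F)"

definition local_diffeo ::
  "('p, 'd::real_normed_vector) atlas \<Rightarrow> ('q, 'e::real_normed_vector) atlas \<Rightarrow> ('p \<Rightarrow> 'q) \<Rightarrow> bool" where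
  "local_diffeo A B F \<longleftrightarrow> (\<forall>p\<in>points A. \<exists>S T. p \<in> S \<and> diffeo_on A B S T F)"


section \<open>Tangent and cotangent bundles\<close>

text \<open>
  Each point has a preferred chart, and its tangent space is identified with the model space by
  means of that chart: \<open>(q, e)\<close> stands for the tangent vector at \<open>q\<close> whose representative in
  the preferred chart at \<open>q\<close> is \<open>e\<close>.  Other charts see it through the derivative of the
  transition map, which is what defines the bundle charts.  Dually, \<open>(q, l)\<close> stands for a
  covector at \<open>q\<close>.  Since \<open>tangent_bundle A\<close> is again an atlas, the second tangent bundle is
  \<open>tangent_bundle (tangent_bundle A)\<close>.
\<close>

definition chart_at :: "('q, 'e) atlas \<Rightarrow> 'q \<Rightarrow> ('q, 'e) chart" where
  "chart_at A q = (SOME c. c \<in> A \<and> q \<in> fst c)"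

definition tangent_chart ::
  "('q, 'e::real_normed_vector) atlas \<Rightarrow> ('q, 'e) chart \<Rightarrow> ('q \<times> 'e, 'e \<times> 'e) chart" where
  "tangent_chart A c =
     (fst c \<times> UNIV,
      \<lambda>(q, e). (snd c q,
        frechet_derivative (transition (chart_at A q) c) (at (snd (chart_at A q) q)) e))"

definition tangent_bundle ::
  "('q, 'e::real_normed_vector) atlas \<Rightarrow> ('q \<times> 'e, 'e \<times> 'e) atlas" where
  "tangent_bundle A = tangent_chart A ` A"

definition cotangent_chart ::
  "('q, 'e::real_normed_vector) atlas \<Rightarrow> ('q, 'e) chart \<Rightarrow>
     ('q \<times> ('e \<Rightarrow>\<^sub>L real), 'e \<times> ('e \<Rightarrow>\<^sub>L real)) chart" where
  "cotangent_chart A c =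
     (fst c \<times> UNIV,
      \<lambda>(q, l). (snd c q,
        l o\<^sub>L Blinfun (frechet_derivative (transition c (chart_at A q)) (at (snd c q)))))"

definition cotangent_bundle ::
  "('q, 'e::real_normed_vector) atlas \<Rightarrow> ('q \<times> ('e \<Rightarrow>\<^sub>L real), 'e \<times> ('e \<Rightarrow>\<^sub>L real)) atlas" where
  "cotangent_bundle A = cotangent_chart A ` A"

text \<open>
  \<open>tangent_map A B F p\<close> is \<open>T\<^sub>pF\<close>, with both tangent spaces identified with the model spaces
  as above; with \<open>B = vec_atlas\<close> it is the differential of a vector-valued function.
\<close>

definition tangent_map ::
  "('p, 'd::real_normed_vector) atlas \<Rightarrow> ('q, 'e::real_normed_vector) atlas \<Rightarrow> ('p \<Rightarrow> 'q) \<Rightarrow> 'p \<Rightarrow> 'd \<Rightarrow> 'e" where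
  "tangent_map A B F p =
     frechet_derivative (snd (chart_at B (F p)) \<circ> F \<circ> chart_inv (chart_at A p))
       (at (snd (chart_at A p) p))"

definition velocity :: "('q, 'e::real_normed_vector) atlas \<Rightarrow> (real \<Rightarrow> 'q) \<Rightarrow> real \<Rightarrow> 'q \<times> 'e" where
  "velocity A q t = (q t, tangent_map vec_atlas A q t 1)"

definition smooth_vector_field :: "('q, 'e::real_normed_vector) atlas \<Rightarrow> ('q \<Rightarrow> 'e) \<Rightarrow> bool" where
  "smooth_vector_field A X \<longleftrightarrow> smooth_map A (tangent_bundle A) (points A) (\<lambda>p. (p, X p))"

definition smooth_one_form :: "('q, 'e::real_normed_vector) atlas \<Rightarrow> ('q \<Rightarrow> 'e \<Rightarrow>\<^sub>L real) \<Rightarrow> bool" where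
  "smooth_one_form A f \<longleftrightarrow> smooth_map A (cotangent_bundle A) (points A) (\<lambda>p. (p, f p))"

definition smooth_curve :: "('q, 'e::real_normed_vector) atlas \<Rightarrow> real set \<Rightarrow> (real \<Rightarrow> 'q) \<Rightarrow> bool" where
  "smooth_curve A I q \<longleftrightarrow> open I \<and> is_interval I \<and> smooth_map vec_atlas A I q"

definition integral_curve ::
  "('q, 'e::real_normed_vector) atlas \<Rightarrow> ('q \<Rightarrow> 'e) \<Rightarrow> real set \<Rightarrow> (real \<Rightarrow> 'q) \<Rightarrow> bool" where
  "integral_curve A X I q \<longleftrightarrow>
     smooth_curve A I q \<and> (\<forall>t\<in>I. velocity A q t = (q t, X (q t)))"

text \<open>
  The (smooth) flow of \<open>X\<close> on an open flow domain \<open>U\<close> with symmetric fibres.  The domain need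
  not be the maximal one.
\<close>

definition is_flow ::
  "('q, 'e::real_normed_vector) atlas \<Rightarrow> ('q \<Rightarrow> 'e) \<Rightarrow> (real \<times> 'q) set \<Rightarrow> (real \<Rightarrow> 'q \<Rightarrow> 'q) \<Rightarrow> bool" where
  "is_flow A X U F \<longleftrightarrow>
     openin (manifold_topology (prod_atlas vec_atlas A)) U \<and>
     {0} \<times> points A \<subseteq> U \<and>
     (\<forall>t p. (t, p) \<in> U \<longrightarrow> (- t, p) \<in> U) \<and>
     smooth_map (prod_atlas vec_atlas A) A U (\<lambda>(t, p). F t p) \<and>
     (\<forall>p\<in>points A. F 0 p = p \<and> integral_curve A X {t. (t, p) \<in> U} (\<lambda>t. F t p))"


section \<open>Forced mechanical systems\<close>

definition horizontal ::
  "('q, 'e::real_normed_vector) atlas \<Rightarrow> ('q \<times> 'e \<Rightarrow> ('e \<times> 'e) \<Rightarrow>\<^sub>L real) \<Rightarrow> bool" where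
  "horizontal A f \<longleftrightarrow>
     (\<forall>v\<in>points (tangent_bundle A). \<forall>w.
        tangent_map (tangent_bundle A) A fst v w = 0 \<longrightarrow> blinfun_apply (f v) w = 0)"

definition forced_mechanical_system ::
  "('q, 'e::real_normed_vector) atlas \<Rightarrow> ('q \<times> 'e \<Rightarrow> real) \<Rightarrow> ('q \<times> 'e \<Rightarrow> ('e \<times> 'e) \<Rightarrow>\<^sub>L real) \<Rightarrow> bool" where
  "forced_mechanical_system A L f \<longleftrightarrow>
     smooth_manifold A \<and>
     smooth_map (tangent_bundle A) vec_atlas (points (tangent_bundle A)) L \<and>
     smooth_one_form (tangent_bundle A) f \<and> horizontal A f"

definition legendre :: "('q \<times> 'e::real_normed_vector \<Rightarrow> real) \<Rightarrow> 'q \<times> 'e \<Rightarrow> 'q \<times> ('e \<Rightarrow>\<^sub>L real)" where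
  "legendre L = (\<lambda>(q, e). (q, Blinfun (\<lambda>w. deriv (\<lambda>t. L (q, e + t *\<^sub>R w)) 0)))"

definition regular_fms ::
  "('q, 'e::real_normed_vector) atlas \<Rightarrow> ('q \<times> 'e \<Rightarrow> real) \<Rightarrow> ('q \<times> 'e \<Rightarrow> ('e \<times> 'e) \<Rightarrow>\<^sub>L real) \<Rightarrow> bool" where
  "regular_fms A L f \<longleftrightarrow>
     forced_mechanical_system A L f \<and>
     local_diffeo (tangent_bundle A) (cotangent_bundle A) (legendre L)"

text \<open>
  Forced Euler--Lagrange equations in every coordinate chart along the curve.  \<open>y\<close> is the
  coordinate expression of \<open>(q(t), q'(t))\<close>; the directions \<open>(e, 0)\<close> and \<open>(0, e)\<close> give the
  partial derivatives with respect to positions and velocities, contracted with \<open>e\<close>, and the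
  last summand is \<open>f\<^sub>i e\<^sup>i\<close>.
\<close>

definition fms_trajectory ::
  "('q, 'e::real_normed_vector) atlas \<Rightarrow> ('q \<times> 'e \<Rightarrow> real) \<Rightarrow> ('q \<times> 'e \<Rightarrow> ('e \<times> 'e) \<Rightarrow>\<^sub>L real) \<Rightarrow>
     real set \<Rightarrow> (real \<Rightarrow> 'q) \<Rightarrow> bool" where
  "fms_trajectory A L f I q \<longleftrightarrow>
     smooth_curve A I q \<and>
     (\<forall>t\<in>I. \<forall>c\<in>A. q t \<in> fst c \<longrightarrow>
        (let \<phi> = tangent_chart A c;
             y = (\<lambda>s. snd \<phi> (velocity A q s))
         in \<forall>e. ((\<lambda>s. frechet_derivative (L \<circ> chart_inv \<phi>) (at (y s)) (0, e))
                   has_real_derivative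
                   frechet_derivative (L \<circ> chart_inv \<phi>) (at (y t)) (e, 0) +
                   blinfun_apply (f (velocity A q t))
                     (tangent_map vec_atlas (tangent_bundle A) (chart_inv \<phi>) (y t) (e, 0)))
                (at t)))"

definition second_order :: "('q, 'e::real_normed_vector) atlas \<Rightarrow> ('q \<times> 'e \<Rightarrow> 'e \<times> 'e) \<Rightarrow> bool" where
  "second_order A X \<longleftrightarrow>
     (\<forall>v\<in>points (tangent_bundle A). tangent_map (tangent_bundle A) A fst v (X v) = snd v)"

text \<open>\<open>X\<close> is the vector field \<open>X\<^sub>L\<^sub>,\<^sub>f\<close>; for a regular system it exists and is unique.\<close>

definition lagrangian_vector_field ::
  "('q, 'e::real_normed_vector) atlas \<Rightarrow> ('q \<times> 'e \<Rightarrow> real) \<Rightarrow> ('q \<times> 'e \<Rightarrow> ('e \<times> 'e) \<Rightarrow>\<^sub>L real) \<Rightarrow>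
     ('q \<times> 'e \<Rightarrow> 'e \<times> 'e) \<Rightarrow> bool" where
  "lagrangian_vector_field A L f X \<longleftrightarrow>
     smooth_vector_field (tangent_bundle A) X \<and> second_order A X \<and>
     (\<forall>I \<gamma>. integral_curve (tangent_bundle A) X I \<gamma> \<longleftrightarrow>
        (\<exists>q. fms_trajectory A L f I q \<and> (\<forall>t\<in>I. \<gamma> t = velocity A q t)))"


section \<open>Exact discretizations\<close>

definition discretization_pair :: "real \<Rightarrow> (real \<Rightarrow> real) \<Rightarrow> (real \<Rightarrow> real) \<Rightarrow> bool" where
  "discretization_pair a0 \<alpha>p \<alpha>m \<longleftrightarrow>
     a0 > 0 \<and> smooth_on {-a0<..<a0} \<alpha>p \<and> smooth_on {-a0<..<a0} \<alpha>m \<and>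
     (\<forall>h\<in>{-a0<..<a0}. h * \<alpha>p h \<ge> 0 \<and> h * \<alpha>m h \<le> 0 \<and> \<alpha>p h - \<alpha>m h = h)"

text \<open>In the following, \<open>F\<close> is the flow of \<open>X\<^sub>L\<^sub>,\<^sub>f\<close>, and \<open>LBINT\<close> is the oriented integral.\<close>

definition exact_psi :: "(real \<Rightarrow> 'q \<times> 'e \<Rightarrow> 'q \<times> 'e) \<Rightarrow> real \<Rightarrow> real \<Rightarrow> 'q \<times> 'e \<Rightarrow> 'q" where
  "exact_psi F h t v = fst (F t v)"

definition exact_L ::
  "('q \<times> 'e \<Rightarrow> real) \<Rightarrow> (real \<Rightarrow> 'q \<times> 'e \<Rightarrow> 'q \<times> 'e) \<Rightarrow> (real \<Rightarrow> real) \<Rightarrow> (real \<Rightarrow> real) \<Rightarrow>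
     real \<Rightarrow> 'q \<times> 'e \<Rightarrow> real" where
  "exact_L L F \<alpha>p \<alpha>m h v = (LBINT t=ereal (\<alpha>m h)..ereal (\<alpha>p h). L (F t v))"

definition exact_f ::
  "('q, 'e::real_normed_vector) atlas \<Rightarrow> ('q \<times> 'e \<Rightarrow> ('e \<times> 'e) \<Rightarrow>\<^sub>L real) \<Rightarrow>
     (real \<Rightarrow> 'q \<times> 'e \<Rightarrow> 'q \<times> 'e) \<Rightarrow> (real \<Rightarrow> real) \<Rightarrow> (real \<Rightarrow> real) \<Rightarrow>
     real \<Rightarrow> 'q \<times> 'e \<Rightarrow> 'e \<times> 'e \<Rightarrow> real" where
  "exact_f A f F \<alpha>p \<alpha>m h v \<delta> =
     (LBINT t=ereal (\<alpha>m h)..ereal (\<alpha>p h).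
        blinfun_apply (f (F t v)) (tangent_map (tangent_bundle A) (tangent_bundle A) (F t) v \<delta>))"

definition exact_bd :: "(real \<Rightarrow> 'q \<times> 'e \<Rightarrow> 'q \<times> 'e) \<Rightarrow> (real \<Rightarrow> real) \<Rightarrow> real \<Rightarrow> 'q \<times> 'e \<Rightarrow> 'q" where
  "exact_bd F \<alpha> h v = exact_psi F h (\<alpha> h) v"

definition exact_bd_pair ::
  "(real \<Rightarrow> 'q \<times> 'e \<Rightarrow> 'q \<times> 'e) \<Rightarrow> (real \<Rightarrow> real) \<Rightarrow> (real \<Rightarrow> real) \<Rightarrow> real \<Rightarrow> 'q \<times> 'e \<Rightarrow> 'q \<times> 'q" where
  "exact_bd_pair F \<alpha>p \<alpha>m h v = (exact_bd F \<alpha>m h v, exact_bd F \<alpha>p h v)"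

definition exact_bd_tilde ::
  "(real \<Rightarrow> 'q \<times> 'e \<Rightarrow> 'q \<times> 'e) \<Rightarrow> (real \<Rightarrow> real) \<Rightarrow> (real \<Rightarrow> real) \<Rightarrow>
     real \<times> 'q \<times> 'e \<Rightarrow> real \<times> 'q \<times> 'q" where
  "exact_bd_tilde F \<alpha>p \<alpha>m = (\<lambda>(h, v). (h, exact_bd_pair F \<alpha>p \<alpha>m h v))"

definition exact_bd_domain ::
  "real \<Rightarrow> (real \<Rightarrow> real) \<Rightarrow> (real \<Rightarrow> real) \<Rightarrow> (real \<times> 'q \<times> 'e) set \<Rightarrow> (real \<times> 'q \<times> 'e) set" where
  "exact_bd_domain a0 \<alpha>p \<alpha>m U = {(h, v). \<bar>h\<bar> < a0 \<and> (\<alpha>p h, v) \<in> U \<and> (\<alpha>m h, v) \<in> U}"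

text \<open>
  The set \<open>\<W>\<^sup>E\<close> is the image of \<open>UE = \<U>\<^sup>E\<close>; it contains \<open>{0} \<times> \<Delta>\<^sub>Q\<close> automatically, because
  \<open>\<alpha>\<^sup>\<plusminus>(0) = 0\<close>.
\<close>

definition admissible_domain ::
  "('q, 'e::real_normed_vector) atlas \<Rightarrow> (real \<times> 'q \<times> 'e) set \<Rightarrow> (real \<Rightarrow> 'q \<times> 'e \<Rightarrow> 'q \<times> 'e) \<Rightarrow>
     real \<Rightarrow> (real \<Rightarrow> real) \<Rightarrow> (real \<Rightarrow> real) \<Rightarrow> (real \<times> 'q \<times> 'e) set \<Rightarrow> bool" where
  "admissible_domain A U F a0 \<alpha>p \<alpha>m UE \<longleftrightarrow>
     openin (manifold_topology (prod_atlas vec_atlas (tangent_bundle A))) UE \<and>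
     UE \<subseteq> U \<inter> exact_bd_domain a0 \<alpha>p \<alpha>m U \<and>
     {0} \<times> points (tangent_bundle A) \<subseteq> UE \<and>
     diffeo_on (prod_atlas vec_atlas (tangent_bundle A)) (prod_atlas vec_atlas (prod_atlas A A))
       (UE - {0} \<times> points (tangent_bundle A))
       (exact_bd_tilde F \<alpha>p \<alpha>m ` UE - {0} \<times> (points A \<times> points A))
       (exact_bd_tilde F \<alpha>p \<alpha>m)"

definition exact_V ::
  "(real \<Rightarrow> 'q \<times> 'e \<Rightarrow> 'q \<times> 'e) \<Rightarrow> (real \<Rightarrow> real) \<Rightarrow> (real \<Rightarrow> real) \<Rightarrow> (real \<times> 'q \<times> 'e) set \<Rightarrow>
     'q set \<Rightarrow> real \<Rightarrow> ('q \<times> 'e) set" where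
  "exact_V F \<alpha>p \<alpha>m UE Q0 h = {v. (h, v) \<in> UE \<and> exact_bd_pair F \<alpha>p \<alpha>m h v \<in> Q0 \<times> Q0}"


section \<open>Trajectories of forced discrete mechanical systems\<close>

text \<open>
  The discrete tangent bundle \<open>V\<close> (with boundary maps \<open>bp\<close>, \<open>bm\<close>) is an open subset of the
  manifold \<open>M\<close>, and the configuration manifold is an open subset of \<open>N\<close>; tangent spaces of open
  subsets are those of the ambient manifolds.
\<close>

definition discrete_trajectory ::
  "('m, 'd::real_normed_vector) atlas \<Rightarrow> ('n, 'e::real_normed_vector) atlas \<Rightarrow> 'm set \<Rightarrow>
     ('m \<Rightarrow> 'n) \<Rightarrow> ('m \<Rightarrow> 'n) \<Rightarrow> ('m \<Rightarrow> real) \<Rightarrow> ('m \<Rightarrow> 'd \<Rightarrow> real) \<Rightarrow> 'm \<Rightarrow> 'm \<Rightarrow> bool" where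
  "discrete_trajectory M N V bp bm Ld fd v v' \<longleftrightarrow>
     v \<in> V \<and> v' \<in> V \<and> bp v = bm v' \<and>
     (\<forall>\<delta> \<delta>'.
        tangent_map M N bm v \<delta> = 0 \<and>
        tangent_map M N bp v \<delta> = tangent_map M N bm v' \<delta>' \<and>
        tangent_map M N bp v' \<delta>' = 0 \<longrightarrow>
        (tangent_map M vec_atlas Ld v \<delta> + fd v \<delta>) +
        (tangent_map M vec_atlas Ld v' \<delta>' + fd v' \<delta>') = 0)"

definition exact_discrete_trajectory ::
  "('q, 'e::real_normed_vector) atlas \<Rightarrow> ('q \<times> 'e \<Rightarrow> real) \<Rightarrow> ('q \<times> 'e \<Rightarrow> ('e \<times> 'e) \<Rightarrow>\<^sub>L real) \<Rightarrow>
     (real \<Rightarrow> 'q \<times> 'e \<Rightarrow> 'q \<times> 'e) \<Rightarrow> (real \<Rightarrow> real) \<Rightarrow> (real \<Rightarrow> real) \<Rightarrow>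
     (real \<times> 'q \<times> 'e) set \<Rightarrow> 'q set \<Rightarrow> real \<Rightarrow> 'q \<times> 'e \<Rightarrow> 'q \<times> 'e \<Rightarrow> bool" where
  "exact_discrete_trajectory A L f F \<alpha>p \<alpha>m UE Q0 h =
     discrete_trajectory (tangent_bundle A) A (exact_V F \<alpha>p \<alpha>m UE Q0 h)
       (exact_bd F \<alpha>p h) (exact_bd F \<alpha>m h)
       (exact_L L F \<alpha>p \<alpha>m h) (exact_f A f F \<alpha>p \<alpha>m h)"

end

theory Submission
  imports Defs
begin

text \<open>
  Everything happens near a single point \<open>(0, v\<^sub>0, v\<^sub>0)\<close>, hence in one chart: the conditions on
  \<open>\<alpha>\<^sup>\<plusminus>\<close> force \<open>\<bar>\<alpha>\<^sup>\<plusminus>(h)\<bar> \<le> \<bar>h\<bar>\<close> for \<open>h \<noteq> 0\<close>, so for small \<open>h\<close> the flow segments over which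
  \<open>L\<^sub>h\<close> and \<open>f\<^sub>h\<close> are integrated stay in that chart.  The neighbourhood asked for is the union of
  the boxes obtained for the individual \<open>v\<^sub>0\<close>.

  Let \<open>p(v) = \<F>L(v)\<close> be the momentum of \<open>v\<close>.  A tangent vector \<open>\<delta>\<close> at \<open>v\<close> induces the
  variation \<open>\<delta>q(t) = T(\<tau> \<circ> F\<^sub>t)(\<delta>)\<close> of the trajectory through \<open>v\<close>.  Since the force is horizontal and
  the field is of second order, the forced Euler--Lagrange equations say exactly that
  \<open>dL + f\<close>, evaluated on \<open>TF\<^sub>t(\<delta>)\<close>, is the time derivative of \<open>p(F\<^sub>t v)(\<delta>q(t))\<close>.
  Integration from \<open>a = \<alpha>\<^sup>-(h)\<close> to \<open>b = \<alpha>\<^sup>+(h)\<close> gives the first variation formula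
  (lemma \<open>first_variation\<close>)

    \<open>(dL\<^sub>h + f\<^sub>h)(v)(\<delta>) = p(F\<^sub>b v)(T\<partial>\<^sup>+ \<delta>) - p(F\<^sub>a v)(T\<partial>\<^sup>- \<delta>)\<close>.

  For a pair \<open>(v, v')\<close> with \<open>\<partial>\<^sup>+ v = \<partial>\<^sup>- v'\<close> and admissible \<open>\<delta>, \<delta>'\<close> the two outer boundary terms
  vanish, and the pair is a trajectory iff \<open>p(F\<^sub>b v)\<close> and \<open>p(F\<^sub>a v')\<close> agree on every vector that
  occurs as the common value \<open>T\<partial>\<^sup>+ \<delta> = T\<partial>\<^sup>- \<delta>'\<close>.  For \<open>h \<noteq> 0\<close> the pair of boundary maps is a local
  diffeomorphism, so that every vector occurs (lemma \<open>boundary_derivative_surj\<close>) and the momenta are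
  equal.  Both lie over the same base point, and \<open>\<F>L\<close> is injective near \<open>v\<^sub>0\<close>; hence the pair
  is a trajectory iff \<open>F\<^sub>b v = F\<^sub>a v'\<close>.  Flowing for time \<open>-a\<close> turns this into
  \<open>v' = F\<^sub>b\<^sub>-\<^sub>a v = F\<^sub>h v\<close> (lemma \<open>flow_step_iff_critical\<close>).

  On the analytic side this takes uniqueness of integral curves for a Lipschitz field over a short time,
  and differentiation under the integral sign.  The latter also yields the equation
  \<open>(\<delta>q)' = \<delta>(q')\<close> without second derivatives of the flow.
\<close>

section \<open>First variation along a Lagrangian flow in coordinates\<close>

text \<open>
  If the distance of the two solutions has the maximum \<open>M\<close>, then the derivative of their difference
  has norm at most \<open>K * M\<close>, hence \<open>M \<le> K * r * M\<close>, and \<open>M = 0\<close> since \<open>K * r < 1\<close>.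
\<close>

lemma ode_unique_short_time:
  fixes x y :: "real \<Rightarrow> 'a::real_normed_vector"
  assumes lip: "K-lipschitz_on S V" and K: "K * r < 1" and r: "0 \<le> r"
    and x: "\<And>t. t \<in> {-r..r} \<Longrightarrow> (x has_vector_derivative V (x t)) (at t within {-r..r})"
    and y: "\<And>t. t \<in> {-r..r} \<Longrightarrow> (y has_vector_derivative V (y t)) (at t within {-r..r})"
    and xS: "\<And>t. t \<in> {-r..r} \<Longrightarrow> x t \<in> S" and yS: "\<And>t. t \<in> {-r..r} \<Longrightarrow> y t \<in> S"
    and init: "x 0 = y 0" and t: "t \<in> {-r..r}"
  shows "x t = y t"
proof -
  define d where "d t = x t - y t" for t
  have d': "(d has_vector_derivative V (x t) - V (y t)) (at t within {-r..r})" if "t \<in> {-r..r}" for t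
    unfolding d_def using x[OF that] y[OF that] by (rule has_vector_derivative_diff)
  have K0: "0 \<le> K" using lip by (rule lipschitz_on_nonneg)
  have cont: "continuous_on {-r..r} (\<lambda>t. norm (d t))"
    by (intro continuous_on_norm) (rule continuous_on_vector_derivative, rule d')
  obtain m where m: "m \<in> {-r..r}" "\<And>s. s \<in> {-r..r} \<Longrightarrow> norm (d s) \<le> norm (d m)"
    using continuous_attains_sup[OF compact_Icc _ cont] r by auto
  have "norm (d m - d 0) \<le> (K * norm (d m)) * norm (m - 0)"
  proof (rule differentiable_bound[where S = "{-r..r}" and f' = "\<lambda>s h. h *\<^sub>R (V (x s) - V (y s))"])
    show "convex {-r..r}" by simp
    show "0 \<in> {-r..r}" using r by simp
    show "m \<in> {-r..r}" by (fact m)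
    fix s assume s: "s \<in> {-r..r}"
    show "(d has_derivative (\<lambda>h. h *\<^sub>R (V (x s) - V (y s)))) (at s within {-r..r})"
      using d'[OF s] by (simp add: has_vector_derivative_def)
    have "norm (V (x s) - V (y s)) \<le> K * norm (d s)"
      using lipschitz_onD[OF lip xS[OF s] yS[OF s]] by (simp add: dist_norm d_def)
    also have "\<dots> \<le> K * norm (d m)" using m(2)[OF s] K0 by (rule mult_left_mono)
    finally have "norm (V (x s) - V (y s)) \<le> K * norm (d m)" .
    then show "onorm (\<lambda>h. h *\<^sub>R (V (x s) - V (y s))) \<le> K * norm (d m)"
      by (intro onorm_bound) (auto simp: K0 mult.commute intro: mult_left_mono)
  qed
  then have "norm (d m) \<le> K * norm (d m) * \<bar>m\<bar>" using init by (simp add: d_def)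
  also have "\<dots> \<le> K * norm (d m) * r" using m(1) K0 by (intro mult_left_mono) auto
  finally have "norm (d m) * (1 - K * r) \<le> 0" by (simp add: algebra_simps)
  then have "norm (d m) \<le> 0" using K by (simp add: mult_le_0_iff)
  then have "norm (d t) \<le> 0" using m(2)[OF t] by simp
  then show ?thesis by (simp add: d_def)
qed

text \<open>
  The product rule when the functional \<open>P s\<close> is only known to be differentiable on the single vector
  \<open>u t\<close>.  This is the form in which the Euler--Lagrange equations provide the derivative of the
  momentum: separately for each direction.  Norm continuity of \<open>P\<close> controls the moving argument.
\<close>

lemma has_real_derivative_pairing:
  fixes P :: "real \<Rightarrow> 'e::real_normed_vector \<Rightarrow>\<^sub>L real"
  assumes P: "isCont P t" and p: "((\<lambda>s. P s (u t)) has_real_derivative p) (at t)"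
    and u: "(u has_vector_derivative u') (at t)"
  shows "((\<lambda>s. P s (u s)) has_real_derivative p + P t u') (at t)"
  unfolding has_field_derivative_iff
proof (rule Lim_transform_eventually)
  have "((\<lambda>s. (P s (u t) - P t (u t)) / (s - t)) \<longlongrightarrow> p) (at t)"
    using p by (simp add: has_field_derivative_iff)
  moreover have "((\<lambda>s. P s ((1 / (s - t)) *\<^sub>R (u s - u t))) \<longlongrightarrow> P t u') (at t)"
  proof (rule blinfun.tendsto)
    show "(P \<longlongrightarrow> P t) (at t)" using P by (simp add: isCont_def)
    have "((\<lambda>s. (1 / norm (s - t)) *\<^sub>R (u s - (u t + (s - t) *\<^sub>R u'))) \<longlongrightarrow> 0) (at t)"
      using u by (simp add: has_vector_derivative_def has_derivative_within)
    then have "((\<lambda>s. norm ((1 / norm (s - t)) *\<^sub>R (u s - (u t + (s - t) *\<^sub>R u')))) \<longlongrightarrow> 0) (at t)"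
      by (rule tendsto_norm_zero)
    then have "((\<lambda>s. norm ((1 / (s - t)) *\<^sub>R (u s - u t) - u')) \<longlongrightarrow> 0) (at t)"
    proof (rule Lim_transform_eventually, unfold eventually_at_filter, intro always_eventually allI impI)
      fix s assume st: "s \<noteq> t"
      have "(1 / (s - t)) *\<^sub>R (u s - u t) - u' = (1 / (s - t)) *\<^sub>R (u s - (u t + (s - t) *\<^sub>R u'))"
        using st by (simp add: scaleR_right_diff_distrib scaleR_right_distrib)
      then show "norm ((1 / norm (s - t)) *\<^sub>R (u s - (u t + (s - t) *\<^sub>R u'))) =
          norm ((1 / (s - t)) *\<^sub>R (u s - u t) - u')" by simp
    qed
    then show "((\<lambda>s. (1 / (s - t)) *\<^sub>R (u s - u t)) \<longlongrightarrow> u') (at t)"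
      by (rule LIM_zero_cancel[OF tendsto_norm_zero_cancel])
  qed
  ultimately show "((\<lambda>s. (P s (u t) - P t (u t)) / (s - t) + P s ((1 / (s - t)) *\<^sub>R (u s - u t)))
      \<longlongrightarrow> p + P t u') (at t)"
    by (rule tendsto_add)
  show "\<forall>\<^sub>F s in at t. (P s (u t) - P t (u t)) / (s - t) + P s ((1 / (s - t)) *\<^sub>R (u s - u t))
      = (P s (u s) - P t (u t)) / (s - t)"
    by (intro always_eventually allI) (simp add: blinfun.bilinear_simps diff_divide_distrib)
qed

text \<open>
  The coordinate picture on a box \<open>I \<times> B\<close>: \<open>G\<close> is the flow of the second-order field \<open>V\<close> with spatial
  derivative \<open>G'\<close>, \<open>l\<close> is the Lagrangian and \<open>\<phi>\<close> the force.  The first component of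
  a point is its position and the second its velocity, so that \<open>l' z (0, e)\<close> is the momentum at \<open>z\<close>
  paired with \<open>e\<close>.
\<close>

locale lagrangian_flow_box =
  fixes I :: "real set" and B \<Omega> :: "('e::banach \<times> 'e) set"
    and G :: "real \<Rightarrow> 'e \<times> 'e \<Rightarrow> 'e \<times> 'e" and G' :: "real \<Rightarrow> 'e \<times> 'e \<Rightarrow> ('e \<times> 'e) \<Rightarrow>\<^sub>L ('e \<times> 'e)"
    and V :: "'e \<times> 'e \<Rightarrow> 'e \<times> 'e"
    and l :: "'e \<times> 'e \<Rightarrow> real" and l' \<phi> :: "'e \<times> 'e \<Rightarrow> ('e \<times> 'e) \<Rightarrow>\<^sub>L real"
  assumes I: "open I" "is_interval I" and B: "open B" "convex B" 
    and G_in: "\<And>t z. t \<in> I \<Longrightarrow> z \<in> B \<Longrightarrow> G t z \<in> \<Omega>"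
    and G_space: "\<And>t z. t \<in> I \<Longrightarrow> z \<in> B \<Longrightarrow> (G t has_derivative G' t z) (at z)"
    and G_joint_cont: "continuous_on (I \<times> B) (\<lambda>(t, z). G t z)"
    and G'_cont: "continuous_on (I \<times> B) (\<lambda>(t, z). G' t z)"
    and G_time: "\<And>t z. t \<in> I \<Longrightarrow> z \<in> B \<Longrightarrow> ((\<lambda>t. G t z) has_vector_derivative V (G t z)) (at t)"
    and V_second_order: "\<And>z. z \<in> \<Omega> \<Longrightarrow> fst (V z) = snd z"
    and l_deriv: "\<And>z. z \<in> \<Omega> \<Longrightarrow> (l has_derivative l' z) (at z)"
    and l'_cont: "continuous_on \<Omega> l'"
    and \<phi>_cont: "continuous_on \<Omega> \<phi>"
    and \<phi>_horizontal: "\<And>z e. z \<in> \<Omega> \<Longrightarrow> \<phi> z (0, e) = 0"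
    and euler_lagrange: "\<And>t z e. t \<in> I \<Longrightarrow> z \<in> B \<Longrightarrow>
      ((\<lambda>s. l' (G s z) (0, e)) has_real_derivative l' (G t z) (e, 0) + \<phi> (G t z) (e, 0)) (at t)"
begin

lemma Icc_subset: "a \<in> I \<Longrightarrow> b \<in> I \<Longrightarrow> {min a b..max a b} \<subseteq> I"
proof
  fix t assume "a \<in> I" "b \<in> I" "t \<in> {min a b..max a b}"
  then show "t \<in> I"
    by (cases "a \<le> b") (auto simp: min_def max_def intro: mem_is_interval_1_I[OF I(2), of a b] mem_is_interval_1_I[OF I(2), of b a])
qed

lemma G_time_cont: "z \<in> B \<Longrightarrow> continuous_on I (\<lambda>t. G t z)"
  by (rule continuous_at_imp_continuous_on, rule ballI, rule has_vector_derivative_continuous, rule G_time)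

lemma G'_time_cont: "z \<in> B \<Longrightarrow> continuous_on I (\<lambda>t. G' t z)"
  using continuous_on_compose2[OF G'_cont, of I "\<lambda>t. (t, z)"]
  by (simp add: image_subset_iff continuous_on_Pair)

lemma leibniz_swapped:
  fixes g :: "real \<Rightarrow> 'e \<times> 'e \<Rightarrow> 'c::banach" and g' :: "real \<Rightarrow> 'e \<times> 'e \<Rightarrow> ('e \<times> 'e) \<Rightarrow>\<^sub>L 'c"
  assumes ab: "{a..b} \<subseteq> I" and z: "z \<in> B"
    and g: "\<And>t w. t \<in> I \<Longrightarrow> w \<in> B \<Longrightarrow> (g t has_derivative g' t w) (at w)"
    and g_cont: "\<And>w. w \<in> B \<Longrightarrow> continuous_on I (\<lambda>t. g t w)"
    and g'_cont: "continuous_on (I \<times> B) (\<lambda>(t, w). g' t w)"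
  shows "((\<lambda>w. integral {a..b} (\<lambda>t. g t w)) has_derivative (\<lambda>d. integral {a..b} (\<lambda>t. g' t z d))) (at z)"
proof -
  have *: "((\<lambda>w. integral (cbox a b) (\<lambda>t. g t w)) has_derivative integral (cbox a b) (\<lambda>t. g' t z)) (at z within B)"
  proof (rule leibniz_rule)
    show "((\<lambda>w. g t w) has_derivative g' t w) (at w within B)" if "w \<in> B" "t \<in> cbox a b" for w t
    proof -
      have "t \<in> I" using that ab by auto
      from g[OF this that(1)] show ?thesis by (rule has_derivative_at_withinI)
    qed
    show "(\<lambda>t. g t w) integrable_on cbox a b" if "w \<in> B" for w
      using integrable_continuous_interval[OF continuous_on_subset[OF g_cont[OF that] ab]] by simp
    show "continuous_on (B \<times> cbox a b) (\<lambda>(w, t). g' t w)"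
    proof -
      have "continuous_on (B \<times> cbox a b) (\<lambda>p. case (snd p, fst p) of (t, w) \<Rightarrow> g' t w)"
        by (rule continuous_on_compose2[OF g'_cont]) (use ab in \<open>auto intro!: continuous_intros\<close>)
      then show ?thesis by (simp add: case_prod_unfold)
    qed
  qed (use z B in auto)
  have **: "integral {a..b} (\<lambda>t. g' t z) d = integral {a..b} (\<lambda>t. g' t z d)" for d
  proof (rule blinfun_apply_integral)
    have "continuous_on I (\<lambda>t. g' t z)"
      using continuous_on_compose2[OF g'_cont, of I "\<lambda>t. (t, z)"] z
      by (simp add: image_subset_iff continuous_on_Pair)
    then show "(\<lambda>t. g' t z) integrable_on {a..b}"
      using ab by (intro integrable_continuous_interval) (rule continuous_on_subset)
  qed
  show ?thesis
    using * unfolding at_within_open[OF z B(1)] cbox_interval by (rule has_derivative_eq_rhs) (simp add: fun_eq_iff **)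
qed

text \<open>
  The velocity of the varied base curve is the variation of the velocity.  Instead of
  exchanging second derivatives, the curve is written as the integral of its velocity, which is
  then differentiated under the integral sign.
\<close>

lemma variation_second_order:
  assumes t: "t \<in> I" and z: "z \<in> B"
  shows "((\<lambda>t. fst (G' t z d)) has_vector_derivative snd (G' t z d)) (at t)"
proof -
  \<comment> \<open>The curve is integrated from a starting time \<open>a < t\<close>, with \<open>t\<close> in the interior of \<open>{a..b}\<close>.\<close>
  obtain e where e: "e > 0" "cball t e \<subseteq> I" using I(1) t open_contains_cball by blast
  define a b where "a = t - e" and "b = t + e"
  have ab: "{a..b} \<subseteq> I" "a < t" "t < b" using e by (auto simp: a_def b_def cball_eq_atLeastAtMost)
  have x: "fst (G s w) = fst (G a w) + integral {a..s} (\<lambda>u. snd (G u w))" if "s \<in> {a..b}" "w \<in> B" for s w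
  proof -
    have "((\<lambda>u. snd (G u w)) has_integral fst (G s w) - fst (G a w)) {a..s}"
    proof (rule fundamental_theorem_of_calculus)
      show "((\<lambda>u. fst (G u w)) has_vector_derivative snd (G u w)) (at u within {a..s})"
        if "u \<in> {a..s}" for u
      proof -
        have uI: "u \<in> I" using that \<open>s \<in> {a..b}\<close> ab by auto
        show ?thesis
          using has_vector_derivative_at_within[OF bounded_linear.has_vector_derivative[OF bounded_linear_fst G_time[OF uI \<open>w \<in> B\<close>]]]
            V_second_order[OF G_in[OF uI \<open>w \<in> B\<close>]] by simp
      qed
    qed (use that in auto)
    then show ?thesis by (simp add: integral_unique)
  qed
  have x': "fst (G' s z d) = fst (G' a z d) + integral {a..s} (\<lambda>u. snd (G' u z d))" if s: "s \<in> {a..b}" for s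
  proof -
    have sI: "s \<in> I" and aI: "a \<in> I" and asI: "{a..s} \<subseteq> I" using s ab by auto
    have 1: "((\<lambda>w. fst (G s w)) has_derivative (\<lambda>d. fst (G' s z d))) (at z)"
      by (intro has_derivative_fst G_space sI z)
    have "((\<lambda>w. fst (G a w) + integral {a..s} (\<lambda>u. snd (G u w))) has_derivative
        (\<lambda>d. fst (G' a z d) + integral {a..s} (\<lambda>u. (blinfun_compose (Blinfun snd) (G' u z)) d))) (at z)"
    proof (intro has_derivative_add has_derivative_fst G_space leibniz_swapped asI aI z)
      show "((\<lambda>w. snd (G u w)) has_derivative blinfun_apply (Blinfun snd o\<^sub>L G' u w)) (at w)"
        if "u \<in> I" "w \<in> B" for u w
        using has_derivative_snd[OF G_space[OF that]]
        by (rule has_derivative_eq_rhs) (simp add: bounded_linear_Blinfun_apply bounded_linear_snd comp_def fun_eq_iff)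
      show "continuous_on I (\<lambda>t. snd (G t w))" if "w \<in> B" for w
        using G_time_cont[OF that] by (rule continuous_on_snd)
      show "continuous_on (I \<times> B) (\<lambda>(t, w). Blinfun snd o\<^sub>L G' t w)"
        using G'_cont by (auto simp: case_prod_unfold intro!: continuous_intros)
    qed
    then have "((\<lambda>w. fst (G s w)) has_derivative
        (\<lambda>d. fst (G' a z d) + integral {a..s} (\<lambda>u. (blinfun_compose (Blinfun snd) (G' u z)) d))) (at z)"
      by (rule has_derivative_transform_within_open[OF _ B(1) z]) (simp add: x[OF s])
    from fun_cong[OF has_derivative_unique[OF 1 this], of d] show ?thesis
      by (simp add: bounded_linear_Blinfun_apply bounded_linear_snd)
  qed
  have "((\<lambda>s. integral {a..s} (\<lambda>u. snd (G' u z d))) has_vector_derivative snd (G' t z d)) (at t within {a..b})"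
  proof (rule integral_has_vector_derivative)
    show "continuous_on {a..b} (\<lambda>u. snd (G' u z d))"
      using continuous_on_subset[OF G'_time_cont[OF z] ab(1)]
      by (auto intro!: continuous_intros)
  qed (use ab in auto)
  then have "((\<lambda>s. integral {a..s} (\<lambda>u. snd (G' u z d))) has_vector_derivative snd (G' t z d)) (at t)"
    using ab by (simp add: at_within_Icc_at)
  then have "((\<lambda>s. fst (G' a z d) + integral {a..s} (\<lambda>u. snd (G' u z d))) has_vector_derivative snd (G' t z d)) (at t)"
    using has_vector_derivative_add[OF has_vector_derivative_const] by fastforce
  then show ?thesis
    by (rule has_vector_derivative_transform_within_open[of _ _ _ "{a<..<b}"])
       (use ab in \<open>simp_all add: x'[symmetric]\<close>)
qed

lemma G_integrand_cont:
  assumes z: "z \<in> B"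
  shows "continuous_on I (\<lambda>t. l' (G t z) (G' t z d))" "continuous_on I (\<lambda>t. \<phi> (G t z) (G' t z d))"
    "continuous_on I (\<lambda>t. l (G t z))"
proof -
  have GO: "(\<lambda>t. G t z) ` I \<subseteq> \<Omega>" using G_in z by blast
  note c = G'_time_cont[OF z] continuous_on_compose2[OF l'_cont G_time_cont[OF z] GO]
    continuous_on_compose2[OF \<phi>_cont G_time_cont[OF z] GO]
  show "continuous_on I (\<lambda>t. l' (G t z) (G' t z d))" "continuous_on I (\<lambda>t. \<phi> (G t z) (G' t z d))"
    using c by (auto intro!: continuous_intros)
  have "continuous_on \<Omega> l"
    using l_deriv by (auto intro!: continuous_at_imp_continuous_on has_derivative_continuous)
  from continuous_on_compose2[OF this G_time_cont[OF z] GO]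
  show "continuous_on I (\<lambda>t. l (G t z))" .
qed

text \<open>
  The integrand of the first variation is an exact time derivative: the Euler--Lagrange equations
  supply the terms in the position component of the variation, and \<open>variation_second_order\<close> the
  one in the velocity component, on which the force does not act.
\<close>

lemma momentum_derivative:
  assumes t: "t \<in> I" and z: "z \<in> B"
  shows "((\<lambda>t. l' (G t z) (0, fst (G' t z d))) has_real_derivative
     l' (G t z) (G' t z d) + \<phi> (G t z) (G' t z d)) (at t)"
proof -
  have GO: "(\<lambda>t. G t z) ` I \<subseteq> \<Omega>" using G_in z by blast
  define j where "j = Blinfun (\<lambda>e::'e. (0::'e, e))"
  have j: "j e = (0, e)" for e 
    by (simp add: j_def bounded_linear_Blinfun_apply bounded_linear_Pair bounded_linear_ident bounded_linear_zero)
  have "continuous_on I (\<lambda>t. l' (G t z) o\<^sub>L j)"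
    using continuous_on_compose2[OF l'_cont G_time_cont[OF z] GO] by (auto intro!: continuous_intros)
  then have cont: "isCont (\<lambda>t. l' (G t z) o\<^sub>L j) t"
    using I(1) t by (simp add: continuous_on_eq_continuous_at)
  have "((\<lambda>s. (l' (G s z) o\<^sub>L j) (fst (G' s z d))) has_real_derivative
     (l' (G t z) (fst (G' t z d), 0) + \<phi> (G t z) (fst (G' t z d), 0)) + (l' (G t z) o\<^sub>L j) (snd (G' t z d))) (at t)"
    by (rule has_real_derivative_pairing[OF cont _ variation_second_order[OF t z]])
       (simp add: j euler_lagrange[OF t z])
  moreover have "l' (G t z) (G' t z d) = l' (G t z) (fst (G' t z d), 0) + l' (G t z) (0, snd (G' t z d))"
    "\<phi> (G t z) (G' t z d) = \<phi> (G t z) (fst (G' t z d), 0) + \<phi> (G t z) (0, snd (G' t z d))"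
    by (simp_all flip: blinfun.add_right)
  ultimately show ?thesis
    using \<phi>_horizontal[OF G_in[OF t z]] by (simp add: j algebra_simps)
qed

lemma action_derivative:
  assumes ab: "a \<in> I" "b \<in> I" and z: "z \<in> B"
  shows "((\<lambda>z. LBINT t=ereal a..ereal b. l (G t z)) has_derivative
    (\<lambda>d. LBINT t=ereal a..ereal b. l' (G t z) (G' t z d))) (at z)"
proof -
  have le: "((\<lambda>z. LBINT t=ereal a..ereal b. l (G t z)) has_derivative
    (\<lambda>d. LBINT t=ereal a..ereal b. l' (G t z) (G' t z d))) (at z)" if ab: "a \<in> I" "b \<in> I" "a \<le> b" for a b
  proof -
    have abI: "{a..b} \<subseteq> I" using Icc_subset[of a b] ab by simp
    have conv: "(LBINT t=ereal a..ereal b. g t) = integral {a..b} g" if "continuous_on I g" for g :: "real \<Rightarrow> real"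
      using continuous_on_subset[OF that abI] ab(3)
      by (intro interval_integral_eq_integral borel_integrable_atLeastAtMost')
    have "((\<lambda>w. integral {a..b} (\<lambda>t. l (G t w))) has_derivative (\<lambda>d. integral {a..b} (\<lambda>t. (l' (G t z) o\<^sub>L G' t z) d))) (at z)"
    proof (rule leibniz_swapped[OF abI z])
      show "((\<lambda>w. l (G t w)) has_derivative (l' (G t w) o\<^sub>L G' t w)) (at w)" if "t \<in> I" "w \<in> B" for t w
        using has_derivative_compose[OF G_space[OF that] l_deriv[OF G_in[OF that]]]
        by (rule has_derivative_eq_rhs) (simp add: fun_eq_iff)
      show "continuous_on (I \<times> B) (\<lambda>(t, w). l' (G t w) o\<^sub>L G' t w)"
      proof -
        have "continuous_on (I \<times> B) (\<lambda>p. l' (G (fst p) (snd p)))"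
          by (rule continuous_on_compose2[OF l'_cont]) (use G_joint_cont G_in in \<open>auto simp: case_prod_unfold\<close>)
        then show ?thesis using G'_cont by (auto simp: case_prod_unfold intro!: continuous_intros)
      qed
    qed (rule G_integrand_cont)
    then have "((\<lambda>w. LBINT t=ereal a..ereal b. l (G t w)) has_derivative (\<lambda>d. integral {a..b} (\<lambda>t. (l' (G t z) o\<^sub>L G' t z) d))) (at z)"
      by (rule has_derivative_transform_within_open[OF _ B(1) z]) (simp add: conv G_integrand_cont)
    then show ?thesis using z by (simp add: conv G_integrand_cont)
  qed
  show ?thesis
  proof (cases "a \<le> b")
    case True then show ?thesis using le ab by blast
  next
    case False
    then have ba: "b \<le> a" by simp
    note r = interval_integral_endpoints_reverse[of "ereal a" "ereal b"]
    show ?thesis unfolding r by (rule has_derivative_minus[OF le[OF ab(2,1) ba]])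
  qed
qed

text \<open>
  By \<open>momentum_derivative\<close> and the fundamental theorem of calculus.  The two integrals are kept apart since they
  are the differential of the discrete Lagrangian and the discrete force.
\<close>

lemma first_variation:
  assumes ab: "a \<in> I" "b \<in> I" and z: "z \<in> B"
  shows "(LBINT t=ereal a..ereal b. l' (G t z) (G' t z d)) + (LBINT t=ereal a..ereal b. \<phi> (G t z) (G' t z d))
    = l' (G b z) (0, fst (G' b z d)) - l' (G a z) (0, fst (G' a z d))"
proof -
  have sub: "{min a b..max a b} \<subseteq> I" using ab by (rule Icc_subset)
  have int: "interval_lebesgue_integrable lborel (ereal a) (ereal b) g" if "continuous_on I g" for g :: "real \<Rightarrow> real"
    using that I(1) sub
    by (intro interval_integrable_isCont) (auto simp: continuous_on_eq_continuous_at min_def max_def split: if_splits)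
  have "(LBINT t=ereal a..ereal b. l' (G t z) (G' t z d)) + (LBINT t=ereal a..ereal b. \<phi> (G t z) (G' t z d))
     = (LBINT t=ereal a..ereal b. l' (G t z) (G' t z d) + \<phi> (G t z) (G' t z d))"
    by (intro interval_lebesgue_integral_add(2)[symmetric] int G_integrand_cont z)
  also have "\<dots> = l' (G b z) (0, fst (G' b z d)) - l' (G a z) (0, fst (G' a z d))"
  proof (rule interval_integral_FTC_finite)
    show "continuous_on {min a b..max a b} (\<lambda>t. l' (G t z) (G' t z d) + \<phi> (G t z) (G' t z d))"
      using sub by (intro continuous_on_add continuous_on_subset[OF G_integrand_cont(1)[OF z]]
          continuous_on_subset[OF G_integrand_cont(2)[OF z]])
    show "((\<lambda>t. l' (G t z) (0, fst (G' t z d))) has_vector_derivative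
        l' (G t z) (G' t z d) + \<phi> (G t z) (G' t z d)) (at t within {min a b..max a b})"
      if "min a b \<le> t" "t \<le> max a b" for t
    proof -
      have "t \<in> I" using sub that by auto
      from momentum_derivative[OF this z] show ?thesis
        by (simp add: has_real_derivative_iff_has_vector_derivative has_vector_derivative_at_within)
    qed
  qed
  finally show ?thesis .
qed

end

text \<open>
  The box is now so small that the field is Lipschitz on \<open>\<Omega>\<close> and that points of \<open>\<Omega>\<close> with equal
  position and momentum are equal, which is what regularity of the Lagrangian means locally.
\<close>

locale regular_flow_box = lagrangian_flow_box +
  fixes K :: real
  assumes zero_in: "0 \<in> I"
    and G_0: "z \<in> B \<Longrightarrow> G 0 z = z"
    and V_lipschitz: "K-lipschitz_on \<Omega> V"
    and legendre_inj: "\<lbrakk>z \<in> \<Omega>; z' \<in> \<Omega>; fst z = fst z'; \<And>e. l' z (0, e) = l' z' (0, e)\<rbrakk> \<Longrightarrow> z = z'"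
begin

text \<open>
  Both sides are, as functions of \<open>s\<close>, integral curves starting at \<open>G t z\<close>.
\<close>

lemma flow_add:
  assumes r: "0 \<le> r" "K * r < 1" and rI: "{-2 * r..2 * r} \<subseteq> I"
    and st: "\<bar>s\<bar> \<le> r" "\<bar>t\<bar> \<le> r" and z: "z \<in> B" and tz: "G t z \<in> B"
  shows "G s (G t z) = G (s + t) z"
proof -
  have I1: "u \<in> I" if "\<bar>u\<bar> \<le> r" for u using that rI r by (intro subsetD[OF rI]) auto
  have I2: "u + t \<in> I" if "\<bar>u\<bar> \<le> r" for u using that st by (intro subsetD[OF rI]) auto
  show ?thesis
  proof (rule ode_unique_short_time[where x = "\<lambda>s. G s (G t z)" and y = "\<lambda>s. G (s + t) z",
        OF V_lipschitz r(2) r(1)])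
    fix u assume "u \<in> {-r..r}"
    then have u: "\<bar>u\<bar> \<le> r" by auto
    show "((\<lambda>s. G s (G t z)) has_vector_derivative V (G u (G t z))) (at u within {-r..r})"
      by (rule has_vector_derivative_at_within[OF G_time[OF I1[OF u] tz]])
    have shift: "((\<lambda>s. s + t) has_vector_derivative 1) (at u)"
      by (auto intro!: derivative_eq_intros)
    have "((\<lambda>s. G s z) \<circ> (\<lambda>s. s + t) has_vector_derivative 1 *\<^sub>R V (G (u + t) z)) (at u)"
      by (rule vector_diff_chain_at[where f = "\<lambda>s. s + t", OF shift G_time[OF I2[OF u] z]])
    then show "((\<lambda>s. G (s + t) z) has_vector_derivative V (G (u + t) z)) (at u within {-r..r})"
      by (simp add: comp_def has_vector_derivative_at_within)
    show "G u (G t z) \<in> \<Omega>" "G (u + t) z \<in> \<Omega>"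
      by (rule G_in[OF I1[OF u] tz], rule G_in[OF I2[OF u] z])
  qed (use st G_0[OF tz] in auto)
qed

text \<open>
  Shifting both sides of \<open>G b z = G a z'\<close> by the time \<open>- a\<close>, and back.
\<close>

lemma flow_step_iff:
  assumes r: "0 \<le> r" "K * r < 1" and rI: "{-2 * r..2 * r} \<subseteq> I"
    and stay: "\<And>t w. \<bar>t\<bar> \<le> r \<Longrightarrow> w \<in> {z, z'} \<Longrightarrow> G t w \<in> B"
    and z: "z \<in> B" "z' \<in> B"
    and ab: "\<bar>a\<bar> \<le> r" "\<bar>b\<bar> \<le> r" "\<bar>b - a\<bar> \<le> r"
  shows "z' = G (b - a) z \<longleftrightarrow> G b z = G a z'"
proof
  assume "z' = G (b - a) z"
  then show "G b z = G a z'"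
    using flow_add[OF r rI ab(1,3) z(1)] stay[OF ab(3)] by simp
next
  assume eq: "G b z = G a z'"
  have "G (- a) (G a z') = G 0 z'"
    using flow_add[OF r rI _ ab(1) z(2), of "- a"] stay[OF ab(1)] ab by simp
  moreover have "G (- a) (G b z) = G (b - a) z"
    using flow_add[OF r rI _ ab(2) z(1), of "- a"] stay[OF ab(2)] ab by simp
  ultimately show "z' = G (b - a) z" using eq G_0[OF z(2)] by simp
qed

text \<open>
  The coordinate version of the theorem.  By \<open>first_variation\<close> the sum in the criticality condition
  collapses to the difference of the momenta at \<open>G b z\<close> and \<open>G a z'\<close>, applied to the common boundary
  variation.  The hypotheses \<open>surj\<close> and \<open>surj'\<close> make every vector such a variation.
\<close>

lemma flow_step_iff_critical:
  assumes r: "0 \<le> r" "K * r < 1" and rI: "{-2 * r..2 * r} \<subseteq> I"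
    and stay: "\<And>t w. \<bar>t\<bar> \<le> r \<Longrightarrow> w \<in> {z, z'} \<Longrightarrow> G t w \<in> B"
    and z: "z \<in> B" "z' \<in> B"
    and ab: "\<bar>a\<bar> \<le> r" "\<bar>b\<bar> \<le> r" "\<bar>b - a\<bar> \<le> r"
    and surj: "\<And>e. \<exists>d. fst (G' a z d) = 0 \<and> fst (G' b z d) = e"
    and surj': "\<And>e. \<exists>d. fst (G' a z' d) = e \<and> fst (G' b z' d) = 0"
  shows "z' = G (b - a) z \<longleftrightarrow> fst (G b z) = fst (G a z') \<and>
    (\<forall>d d'. fst (G' a z d) = 0 \<and> fst (G' b z d) = fst (G' a z' d') \<and> fst (G' b z' d') = 0 \<longrightarrow>
      ((LBINT t=ereal a..ereal b. l' (G t z) (G' t z d)) + (LBINT t=ereal a..ereal b. \<phi> (G t z) (G' t z d))) +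
      ((LBINT t=ereal a..ereal b. l' (G t z') (G' t z' d')) + (LBINT t=ereal a..ereal b. \<phi> (G t z') (G' t z' d'))) = 0)"
    (is "_ \<longleftrightarrow> _ \<and> ?crit")
proof -
  have I: "a \<in> I" "b \<in> I" using ab rI by (auto intro!: subsetD[OF rI])
  have pair0: "l' w (0, 0) = 0" for w
    using blinfun.zero_right[of "l' w"] by (simp add: zero_prod_def)
  have "?crit \<longleftrightarrow> (\<forall>d d'. fst (G' a z d) = 0 \<and> fst (G' b z d) = fst (G' a z' d') \<and> fst (G' b z' d') = 0 \<longrightarrow>
       l' (G b z) (0, fst (G' b z d)) = l' (G a z') (0, fst (G' b z d)))"
    unfolding first_variation[OF I z(1)] first_variation[OF I z(2)]
    by (intro iff_allI imp_cong refl) (auto simp: pair0)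
  also have "\<dots> \<longleftrightarrow> (\<forall>e. l' (G b z) (0, e) = l' (G a z') (0, e))"
    using surj surj' by metis
  finally have "fst (G b z) = fst (G a z') \<and> ?crit \<longleftrightarrow> G b z = G a z'"
    using legendre_inj[OF G_in[OF I(2) z(1)] G_in[OF I(1) z(2)]] by auto
  then show ?thesis
    using flow_step_iff[OF r rI stay z ab] by blast
qed

end

section \<open>Atlases with differentiable transition maps\<close>

lemma smooth_on_imp_C1:
  assumes "smooth_on S f"
  shows "\<exists>f'. (\<forall>x\<in>S. (f has_derivative blinfun_apply (f' x)) (at x)) \<and> continuous_on S f'"
proof -
  have "Ck_on (Suc 0) S f" using assms by (simp add: smooth_on_def)
  then show ?thesis by auto
qed

text \<open>
  Two derivatives are taken because the charts of the tangent bundle involve the derivative of a transition map,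
  and that has to be differentiated once more.
\<close>

lemma smooth_on_imp_C2:
  assumes "smooth_on S f"
  obtains f' where "\<And>x. x \<in> S \<Longrightarrow> (f has_derivative blinfun_apply (f' x)) (at x)" "continuous_on S f'"
    "\<And>x v. x \<in> S \<Longrightarrow> (\<lambda>x. f' x v) differentiable at x"
proof -
  have "Ck_on (Suc (Suc 0)) S f" using assms unfolding smooth_on_def by blast
  then obtain f' where f': "\<And>x. x \<in> S \<Longrightarrow> (f has_derivative blinfun_apply (f' x)) (at x)" "continuous_on S f'"
    "\<And>v. Ck_on (Suc 0) S (\<lambda>x. f' x v)" by auto
  have "(\<lambda>x. f' x v) differentiable at x" if "x \<in> S" for x v
    using f'(3)[of v] that by (auto simp: differentiable_def)
  with f' that show ?thesis by blast
qed

text \<open>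
  The components, with respect to the chart \<open>c\<close>, of a tangent vector at \<open>p\<close>; tangent vectors themselves
  are stored by their components in the preferred chart at \<open>p\<close>.
\<close>

definition tangent_coord ::
  "('q, 'e::real_normed_vector) atlas \<Rightarrow> ('q, 'e) chart \<Rightarrow> 'q \<Rightarrow> 'e \<Rightarrow> 'e" where
  "tangent_coord A c p =
     frechet_derivative (transition (chart_at A p) c) (at (snd (chart_at A p) p))"

lemma fst_tangent_chart: "fst (tangent_chart A c) = fst c \<times> UNIV"
  by (simp add: tangent_chart_def)

lemma snd_tangent_chart: "snd (tangent_chart A c) = (\<lambda>(q, e). (snd c q, tangent_coord A c q e))"
  by (simp add: tangent_chart_def tangent_coord_def)

lemma chart_at_in:
  assumes "p \<in> points A"
  shows "chart_at A p \<in> A" "p \<in> fst (chart_at A p)"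
proof -
  have "\<exists>c. c \<in> A \<and> p \<in> fst c" using assms by (auto simp: points_def)
  from someI_ex[OF this] show "chart_at A p \<in> A" "p \<in> fst (chart_at A p)"
    by (auto simp: chart_at_def)
qed

lemma pointsI: "c \<in> A \<Longrightarrow> p \<in> fst c \<Longrightarrow> p \<in> points A"
  by (auto simp: points_def)

text \<open>
  The part of the manifold structure that the chain rule consumes.  Unlike smoothness, it passes
  from a manifold to its tangent bundle by an argument that differentiates the transition maps only twice.
\<close>

locale differentiable_atlas =
  fixes A :: "('q, 'e::real_normed_vector) atlas"
  assumes chart_inj: "c \<in> A \<Longrightarrow> inj_on (snd c) (fst c)"
    and overlap_open: "c \<in> A \<Longrightarrow> d \<in> A \<Longrightarrow> open (snd c ` (fst c \<inter> fst d))"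
    and transition_differentiable:
      "c \<in> A \<Longrightarrow> d \<in> A \<Longrightarrow> p \<in> fst c \<inter> fst d \<Longrightarrow> transition c d differentiable at (snd c p)"
begin

lemma chart_inv_chart [simp]: "c \<in> A \<Longrightarrow> p \<in> fst c \<Longrightarrow> chart_inv c (snd c p) = p"
  by (simp add: chart_inv_def chart_inj inv_into_f_f)

lemma chart_image_open: "c \<in> A \<Longrightarrow> open (snd c ` fst c)"
  using overlap_open[of c c] by simp

lemma transition_chart [simp]: "c \<in> A \<Longrightarrow> p \<in> fst c \<Longrightarrow> transition c d (snd c p) = snd d p"
  by (simp add: transition_def)

lemma transition_deriv:
  assumes "c \<in> A" "d \<in> A" "p \<in> fst c" "p \<in> fst d"
  shows "(transition c d has_derivative frechet_derivative (transition c d) (at (snd c p))) (at (snd c p))"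
  using transition_differentiable[of c d p] assms frechet_derivative_works by blast

lemma transition_continuous:
  assumes "c \<in> A" "d \<in> A"
  shows "continuous_on (snd c ` (fst c \<inter> fst d)) (transition c d)"
proof (rule continuous_at_imp_continuous_on, clarify)
  fix p assume "p \<in> fst c" "p \<in> fst d"
  from has_derivative_continuous[OF transition_deriv[OF assms this]]
  show "isCont (transition c d) (snd c p)" .
qed

text \<open>
  The chain rule for the composition of two changes of charts.
\<close>

lemma transition_cocycle:
  assumes A: "c \<in> A" "d \<in> A" "k \<in> A" and p: "p \<in> fst c" "p \<in> fst d" "p \<in> fst k"
  shows "frechet_derivative (transition d k) (at (snd d p))
      (frechet_derivative (transition c d) (at (snd c p)) w) =
    frechet_derivative (transition c k) (at (snd c p)) w"
proof -
  let ?O = "snd c ` (fst c \<inter> fst d)"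
  have "((\<lambda>x. transition d k (transition c d x)) has_derivative
     (\<lambda>w. frechet_derivative (transition d k) (at (snd d p))
      (frechet_derivative (transition c d) (at (snd c p)) w))) (at (snd c p))"
    using has_derivative_compose[OF transition_deriv[OF A(1,2) p(1,2)], of "transition d k"]
      transition_deriv[OF A(2,3) p(2,3)] A p by simp
  then have "(transition c k has_derivative
     (\<lambda>w. frechet_derivative (transition d k) (at (snd d p))
      (frechet_derivative (transition c d) (at (snd c p)) w))) (at (snd c p))"
    by (rule has_derivative_transform_within_open[where s = ?O])
      (use A p overlap_open in auto)
  from fun_cong[OF has_derivative_unique[OF this transition_deriv[OF A(1,3) p(1,3)]], of w] show ?thesis .
qed

lemma transition_deriv_self:
  assumes "c \<in> A" "p \<in> fst c"
  shows "frechet_derivative (transition c c) (at (snd c p)) w = w"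
proof -
  have "(transition c c has_derivative (\<lambda>w. w)) (at (snd c p))"
    by (rule has_derivative_transform_within_open[OF has_derivative_ident, where s = "snd c ` fst c"])
      (use assms chart_image_open in auto)
  from fun_cong[OF has_derivative_unique[OF this transition_deriv[OF assms(1,1) assms(2,2)]], of w]
  show ?thesis by (rule sym)
qed

lemma tangent_coord_change:
  assumes "c \<in> A" "d \<in> A" "p \<in> fst c" "p \<in> fst d"
  shows "frechet_derivative (transition c d) (at (snd c p)) (tangent_coord A c p w) = tangent_coord A d p w"
  unfolding tangent_coord_def
  using assms chart_at_in[OF pointsI[of c A p]] by (intro transition_cocycle) auto

lemma tangent_coord_linear:
  assumes "c \<in> A" "p \<in> fst c"
  shows "bounded_linear (tangent_coord A c p)"
  unfolding tangent_coord_def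
  using assms chart_at_in[OF pointsI[of c A p]] by (intro has_derivative_bounded_linear[OF transition_deriv]) auto

lemma tangent_coord_inverse:
  assumes "c \<in> A" "p \<in> fst c"
  shows "frechet_derivative (transition c (chart_at A p)) (at (snd c p)) (tangent_coord A c p w) = w"
    "tangent_coord A c p (frechet_derivative (transition c (chart_at A p)) (at (snd c p)) w) = w"
proof -
  let ?k = "chart_at A p"
  have k: "?k \<in> A" "p \<in> fst ?k" using chart_at_in[OF pointsI[OF assms]] by auto
  show "frechet_derivative (transition c ?k) (at (snd c p)) (tangent_coord A c p w) = w"
    unfolding tangent_coord_def using transition_cocycle[of ?k c ?k p w] assms k by (simp add: transition_deriv_self)
  show "tangent_coord A c p (frechet_derivative (transition c ?k) (at (snd c p)) w) = w"
    unfolding tangent_coord_def using transition_cocycle[of c ?k c p w] assms k by (simp add: transition_deriv_self)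
qed

lemma tangent_coord_bij:
  assumes "c \<in> A" "p \<in> fst c"
  shows "bij (tangent_coord A c p)"
  using tangent_coord_inverse[OF assms] by (intro bijI) (metis injI, metis surjI)

lemma tangent_coord_eq_iff:
  assumes "c \<in> A" "p \<in> fst c"
  shows "tangent_coord A c p w = tangent_coord A c p w' \<longleftrightarrow> w = w'"
  using tangent_coord_bij[OF assms] by (simp add: bij_def inj_eq)

lemma tangent_coord_eq_0_iff:
  assumes "c \<in> A" "p \<in> fst c"
  shows "tangent_coord A c p w = 0 \<longleftrightarrow> w = 0"
  using tangent_coord_eq_iff[OF assms, of w 0] linear_0[OF bounded_linear.linear[OF tangent_coord_linear[OF assms]]] by simp

lemma openin_iff: "openin (manifold_topology A) W \<longleftrightarrow> W \<subseteq> points A \<and> (\<forall>c\<in>A. open (snd c ` (W \<inter> fst c)))"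
  by (rule openin_manifold_topology) (rule chart_inj)

end

text \<open>
  Tangent maps may be computed in any pair of charts.  The neighbourhood \<open>N\<close> expresses that \<open>F\<close> maps
  points near \<open>p\<close> into the domain of \<open>d\<close>; without it the representative would be meaningless off \<open>p\<close>.
\<close>

lemma tangent_map_coord:
  assumes "differentiable_atlas A" "differentiable_atlas B"
    and c: "c \<in> A" "p \<in> fst c" and d: "d \<in> B" "F p \<in> fst d"
    and O: "open N" "snd c p \<in> N" "\<And>x. x \<in> N \<Longrightarrow> F (chart_inv c x) \<in> fst d"
    and D: "((\<lambda>x. snd d (F (chart_inv c x))) has_derivative D) (at (snd c p))"
  shows "tangent_coord B d (F p) (tangent_map A B F p w) = D (tangent_coord A c p w)"
proof -
  interpret A: differentiable_atlas A by fact
  interpret B: differentiable_atlas B by fact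
  let ?c = "chart_at A p" and ?d = "chart_at B (F p)"
  have c': "?c \<in> A" "p \<in> fst ?c" using chart_at_in[OF pointsI[OF c]] by auto
  have d': "?d \<in> B" "F p \<in> fst ?d" using chart_at_in[OF pointsI[OF d]] by auto
  let ?g = "\<lambda>x. snd d (F (chart_inv c x))"
  let ?S = "snd ?c ` (fst ?c \<inter> fst c)"
  let ?W = "?S \<inter> transition ?c c -` N"
  have W: "open ?W"
    by (rule continuous_open_preimage[OF A.transition_continuous A.overlap_open]) (use c c' O in auto)
  have "((\<lambda>x. transition d ?d (?g (transition ?c c x))) has_derivative
    (\<lambda>w. frechet_derivative (transition d ?d) (at (snd d (F p))) (D (tangent_coord A c p w)))) (at (snd ?c p))"
  proof -
    have 1: "(transition ?c c has_derivative tangent_coord A c p) (at (snd ?c p))"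
      unfolding tangent_coord_def by (rule A.transition_deriv) (use c c' in auto)
    have 2: "(?g has_derivative D) (at (transition ?c c (snd ?c p)))"
      using D c c' by simp
    have 3: "(transition d ?d has_derivative frechet_derivative (transition d ?d) (at (snd d (F p))))
       (at (?g (transition ?c c (snd ?c p))))"
      using B.transition_deriv[of d ?d "F p"] c c' d d' by simp
    show ?thesis by (rule has_derivative_compose[OF has_derivative_compose[OF 1 2] 3])
  qed
  then have "((snd ?d \<circ> F \<circ> chart_inv ?c) has_derivative
    (\<lambda>w. frechet_derivative (transition d ?d) (at (snd d (F p))) (D (tangent_coord A c p w)))) (at (snd ?c p))"
  proof (rule has_derivative_transform_within_open[OF _ W])
    show "snd ?c p \<in> ?W" using c c' O by auto
    show "transition d ?d (?g (transition ?c c x)) = (snd ?d \<circ> F \<circ> chart_inv ?c) x" if "x \<in> ?W" for x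
      using that c c' d d' O(3)[of "transition ?c c x"] by auto
  qed
  then have "tangent_map A B F p =
     (\<lambda>w. frechet_derivative (transition d ?d) (at (snd d (F p))) (D (tangent_coord A c p w)))"
    unfolding tangent_map_def by (metis frechet_derivative_at)
  then show ?thesis using B.tangent_coord_inverse(2)[OF d] by simp
qed

lemma differentiable_atlas_vec: "differentiable_atlas (vec_atlas :: ('a::real_normed_vector, 'a) atlas)"
proof
  fix c d :: "('a, 'a) chart" and p :: 'a
  assume cd: "c \<in> vec_atlas" "d \<in> vec_atlas"
  show "inj_on (snd c) (fst c)" using cd by (simp add: vec_atlas_def)
  show "open (snd c ` (fst c \<inter> fst d))" using cd by (simp add: vec_atlas_def)
  have "transition c d = (\<lambda>x. x)"
    using cd by (auto simp: vec_atlas_def transition_def chart_inv_def inv_into_f_f inj_on_def)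
  then show "transition c d differentiable at (snd c p)" by simp
qed

lemma smooth_manifold_imp_differentiable_atlas:
  assumes "smooth_manifold A"
  shows "differentiable_atlas A"
proof
  fix c d p
  assume cd: "c \<in> A" "d \<in> A"
  show "inj_on (snd c) (fst c)" "open (snd c ` (fst c \<inter> fst d))"
    using assms cd by (auto simp: smooth_manifold_def)
  assume p: "p \<in> fst c \<inter> fst d"
  have "smooth_on (snd c ` (fst c \<inter> fst d)) (transition c d)"
    using assms cd by (auto simp: smooth_manifold_def)
  then show "transition c d differentiable at (snd c p)"
    using p smooth_on_imp_C1 by (fastforce simp: differentiable_def)
qed

text \<open>
  Split \<open>M y u = M y e + M y (u - e)\<close>.  The first summand is differentiable by \<open>diff\<close>; in the second one the argument is
  already of first order, so that continuity of \<open>M\<close> suffices.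
\<close>

lemma blinfun_family_differentiable:
  fixes M :: "'a::real_normed_vector \<Rightarrow> 'b::real_normed_vector \<Rightarrow>\<^sub>L 'c::real_normed_vector"
  assumes cont: "isCont M x" and diff: "(\<lambda>x. M x e) differentiable at x"
  shows "(\<lambda>(x, e). M x e) differentiable at (x, e)"
proof -
  obtain g where g: "((\<lambda>x. M x e) has_derivative g) (at x)" using diff by (auto simp: differentiable_def)
  have 1: "((\<lambda>p. M (fst p) e) has_derivative (\<lambda>p. g (fst p))) (at (x, e))"
    by (rule has_derivative_compose[of fst fst]) (use g in \<open>auto intro: has_derivative_fst has_derivative_ident\<close>)
  have 2: "((\<lambda>p. M (fst p) (snd p - e)) has_derivative (\<lambda>p. M x (snd p))) (at (x, e))"
    unfolding has_derivative_at_alt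
  proof (intro conjI allI impI)
    show "bounded_linear (\<lambda>p. blinfun_apply (M x) (snd p))"
      by (intro bounded_linear_compose[OF blinfun.bounded_linear_right] bounded_linear_snd)
    fix \<epsilon> :: real assume "\<epsilon> > 0"
    then obtain \<delta> where \<delta>: "\<delta> > 0" "\<And>y. dist y x < \<delta> \<Longrightarrow> dist (M y) (M x) < \<epsilon>"
      using cont unfolding continuous_at_eps_delta by blast
    show "\<exists>d>0. \<forall>q. norm (q - (x, e)) < d \<longrightarrow>
       norm (M (fst q) (snd q - e) - M (fst (x, e)) (snd (x, e) - e) - M x (snd (q - (x, e))))
        \<le> \<epsilon> * norm (q - (x, e))"
    proof (intro exI[of _ \<delta>] conjI allI impI \<open>\<delta> > 0\<close>)
      fix q assume q: "norm (q - (x, e)) < \<delta>"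
      have q': "q - (x, e) = (fst q - x, snd q - e)" by (cases q) simp
      have "norm (fst q - x) < \<delta>" using norm_fst_le[of "fst q - x" "snd q - e"] q by (simp add: q')
      then have "norm (M (fst q) - M x) \<le> \<epsilon>" using \<delta>(2)[of "fst q"] by (simp add: dist_norm)
      moreover have "norm (snd q - e) \<le> norm (q - (x, e))" using norm_snd_le[of "snd q - e" "fst q - x"] by (simp add: q')
      ultimately have "norm ((M (fst q) - M x) (snd q - e)) \<le> \<epsilon> * norm (q - (x, e))"
        using norm_blinfun[of "M (fst q) - M x" "snd q - e"] \<open>\<epsilon> > 0\<close>
        by (smt (verit) mult_mono norm_ge_zero)
      then show "norm (M (fst q) (snd q - e) - M (fst (x, e)) (snd (x, e) - e) - M x (snd (q - (x, e))))
        \<le> \<epsilon> * norm (q - (x, e))"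
        by (simp add: blinfun.bilinear_simps algebra_simps)
    qed
  qed
  have "((\<lambda>p. M (fst p) e + M (fst p) (snd p - e)) has_derivative (\<lambda>p. g (fst p) + M x (snd p))) (at (x, e))"
    by (rule has_derivative_add[OF 1 2])
  moreover have "(\<lambda>p. M (fst p) e + M (fst p) (snd p - e)) = (\<lambda>(x, e). M x e)"
    by (auto simp: fun_eq_iff blinfun.bilinear_simps)
  ultimately show ?thesis by (auto simp: differentiable_def)
qed

lemma points_vec [simp]: "points vec_atlas = UNIV"
  by (simp add: points_def vec_atlas_def)

lemma points_prod: "points (prod_atlas A B) = points A \<times> points B"
proof -
  have "(p, q) \<in> points (prod_atlas A B) \<longleftrightarrow> (\<exists>c\<in>A. \<exists>d\<in>B. p \<in> fst c \<and> q \<in> fst d)" for p q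
  proof
    assume "(p, q) \<in> points (prod_atlas A B)"
    then obtain k where "k \<in> prod_atlas A B" and pq: "(p, q) \<in> fst k" by (auto simp: points_def)
    then obtain c d where "c \<in> A" "d \<in> B" "k = (fst c \<times> fst d, map_prod (snd c) (snd d))"
      by (auto simp: prod_atlas_def)
    with pq show "\<exists>c\<in>A. \<exists>d\<in>B. p \<in> fst c \<and> q \<in> fst d" by auto
  next
    assume "\<exists>c\<in>A. \<exists>d\<in>B. p \<in> fst c \<and> q \<in> fst d"
    then obtain c d where "c \<in> A" "d \<in> B" and pq: "p \<in> fst c" "q \<in> fst d" by blast
    then have "(fst c \<times> fst d, map_prod (snd c) (snd d)) \<in> prod_atlas A B" unfolding prod_atlas_def by blast
    then show "(p, q) \<in> points (prod_atlas A B)" by (rule pointsI) (use pq in simp)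
  qed
  then have "x \<in> points (prod_atlas A B) \<longleftrightarrow> x \<in> points A \<times> points B" for x
    by (cases x) (simp add: points_def[of A] points_def[of B])
  then show ?thesis by blast
qed

text \<open>
  The transition map of two bundle charts is \<open>(x, e) \<mapsto> (T x, DT(x) e)\<close>, where \<open>T\<close> is the transition
  map of the underlying charts; its second component is covered by \<open>blinfun_family_differentiable\<close>.
\<close>

lemma differentiable_atlas_tangent_bundle:
  assumes A: "smooth_manifold A"
  shows "differentiable_atlas (tangent_bundle A)"
proof -
  interpret A: differentiable_atlas A using A by (rule smooth_manifold_imp_differentiable_atlas)
  note [simp] = fst_tangent_chart
  have img: "snd (tangent_chart A c) ` ((fst c \<inter> fst d) \<times> UNIV) = (snd c ` (fst c \<inter> fst d)) \<times> UNIV"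
    if cd: "c \<in> A" "d \<in> A" for c d
  proof -
    have "(snd c p, w) \<in> snd (tangent_chart A c) ` ((fst c \<inter> fst d) \<times> UNIV)"
      if p: "p \<in> fst c" "p \<in> fst d" for p w
    proof
      show "(snd c p, w) = snd (tangent_chart A c)
         (p, frechet_derivative (transition c (chart_at A p)) (at (snd c p)) w)"
        using A.tangent_coord_inverse(2)[OF cd(1) p(1)] by (simp add: snd_tangent_chart)
    qed (use p in auto)
    then show ?thesis by (auto simp: snd_tangent_chart)
  qed
  have inj: "inj_on (snd (tangent_chart A c)) (fst c \<times> UNIV)" if c: "c \<in> A" for c
  proof (rule inj_onI, clarify)
    fix p w q u assume p: "p \<in> fst c" and q: "q \<in> fst c"
      and eq: "snd (tangent_chart A c) (p, w) = snd (tangent_chart A c) (q, u)"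
    have pq: "p = q" using eq inj_onD[OF A.chart_inj[OF c] _ p q] by (simp add: snd_tangent_chart)
    with eq A.tangent_coord_eq_iff[OF c p] show "p = q \<and> w = u" by (simp add: snd_tangent_chart)
  qed
  show ?thesis
  proof
    fix \<phi> \<psi> v assume "\<phi> \<in> tangent_bundle A" "\<psi> \<in> tangent_bundle A"
    then obtain c d where cd: "c \<in> A" "d \<in> A" and \<phi>: "\<phi> = tangent_chart A c" and \<psi>: "\<psi> = tangent_chart A d"
      by (auto simp: tangent_bundle_def)
    show "inj_on (snd \<phi>) (fst \<phi>)" using inj[OF cd(1)] by (simp add: \<phi>)
    have ov: "fst \<phi> \<inter> fst \<psi> = (fst c \<inter> fst d) \<times> UNIV" by (auto simp: \<phi> \<psi>)
    show "open (snd \<phi> ` (fst \<phi> \<inter> fst \<psi>))"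
      unfolding ov by (simp add: \<phi> img[OF cd] open_Times A.overlap_open[OF cd])
    assume v: "v \<in> fst \<phi> \<inter> fst \<psi>"
    let ?S = "snd c ` (fst c \<inter> fst d)"
    have "smooth_on ?S (transition c d)" using A cd by (auto simp: smooth_manifold_def)
    then obtain M where M: "\<And>x. x \<in> ?S \<Longrightarrow> (transition c d has_derivative blinfun_apply (M x)) (at x)"
      "continuous_on ?S M" "\<And>x v. x \<in> ?S \<Longrightarrow> (\<lambda>x. M x v) differentiable at x"
      by (rule smooth_on_imp_C2) blast
    obtain p w where vp: "v = (p, w)" "p \<in> fst c" "p \<in> fst d" using v ov by (cases v) auto
    have x: "fst (snd \<phi> v) \<in> ?S" using vp by (simp add: \<phi> snd_tangent_chart)
    define y where "y = snd \<phi> v"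
    have y: "fst y \<in> ?S" using x by (simp add: y_def)
    have "isCont M (fst y)" using M(2) y continuous_on_eq_continuous_at[OF A.overlap_open[OF cd]] by blast
    from blinfun_family_differentiable[OF this M(3)[OF y], of "snd y"]
    obtain D2 where D2: "((\<lambda>(x, e). M x e) has_derivative D2) (at y)" by (auto simp: differentiable_def)
    have D1: "((\<lambda>y. transition c d (fst y)) has_derivative (\<lambda>u. M (fst y) (fst u))) (at y)"
      by (rule has_derivative_compose[of fst fst]) (use M(1)[OF y] in \<open>auto intro: has_derivative_fst has_derivative_ident\<close>)
    have "(transition \<phi> \<psi> has_derivative (\<lambda>u. (M (fst y) (fst u), D2 u))) (at y)"
    proof (rule has_derivative_transform_within_open[OF has_derivative_Pair[OF D1 D2], where s = "?S \<times> UNIV"])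
      show "open (?S \<times> UNIV)" by (simp add: open_Times A.overlap_open[OF cd])
      show "y \<in> ?S \<times> UNIV" using y by (cases y) auto
      fix z assume "z \<in> ?S \<times> (UNIV :: 'b set)"
      then have "z \<in> snd \<phi> ` ((fst c \<inter> fst d) \<times> UNIV)" using img[OF cd] \<phi> by auto
      then obtain q u where q: "q \<in> fst c" "q \<in> fst d" and z: "z = snd \<phi> (q, u)" by auto
      have "chart_inv \<phi> z = (q, u)"
        using inj[OF cd(1)] q by (simp add: chart_inv_def z \<phi> inv_into_f_f)
      moreover have "blinfun_apply (M (snd c q)) = frechet_derivative (transition c d) (at (snd c q))" 
        using M(1)[of "snd c q"] q by (auto intro: frechet_derivative_at)
      ultimately show "(transition c d (fst z), case z of (x, e) \<Rightarrow> M x e) = transition \<phi> \<psi> z"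
        using A.tangent_coord_change[OF cd q, of u] q cd
        by (simp add: z transition_def) (simp add: \<phi> \<psi> snd_tangent_chart)
    qed
    then show "transition \<phi> \<psi> differentiable at (snd \<phi> v)" by (auto simp: differentiable_def y_def)
  qed
qed

lemma prod_chart_inj:
  assumes "\<And>c. c \<in> A \<Longrightarrow> inj_on (snd c) (fst c)" "\<And>c. c \<in> B \<Longrightarrow> inj_on (snd c) (fst c)"
    and "k \<in> prod_atlas A B"
  shows "inj_on (snd k) (fst k)"
proof -
  obtain c d where cd: "c \<in> A" "d \<in> B" and k: "k = (fst c \<times> fst d, map_prod (snd c) (snd d))"
    using assms(3) by (auto simp: prod_atlas_def)
  show ?thesis using map_prod_inj_on[OF assms(1)[OF cd(1)] assms(2)[OF cd(2)]] by (simp add: k)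
qed

lemma (in differentiable_atlas) openin_vec_prod_imp_open:
  fixes W :: "('a::real_normed_vector \<times> 'q) set"
  assumes W: "openin (manifold_topology (prod_atlas vec_atlas A)) W" and c: "c \<in> A"
  shows "open ((\<lambda>(t, v). (t, snd c v)) ` (W \<inter> UNIV \<times> fst c))"
proof -
  let ?k = "(UNIV \<times> fst c, map_prod (\<lambda>x. x) (snd c)) :: ('a \<times> 'q, 'a \<times> 'e) chart"
  have k: "?k \<in> prod_atlas vec_atlas A" using c by (force simp: prod_atlas_def vec_atlas_def)
  have inj: "inj_on (snd k) (fst k)" if "k \<in> prod_atlas (vec_atlas :: ('a, 'a) atlas) A" for k
    by (rule prod_chart_inj[OF _ chart_inj that]) (auto simp: vec_atlas_def)
  have "openin (manifold_topology (prod_atlas vec_atlas A)) W \<longleftrightarrow>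
      W \<subseteq> points (prod_atlas vec_atlas A) \<and> (\<forall>k\<in>prod_atlas vec_atlas A. open (snd k ` (W \<inter> fst k)))"
    by (rule openin_manifold_topology) (rule inj)
  then have "open (snd ?k ` (W \<inter> fst ?k))" using W k by blast
  then show ?thesis by (simp add: map_prod_def)
qed

text \<open>
  A subset of the threefold product that is open in one product chart is open in all of them, since the transition
  maps are continuous.  The sets of this form are the pieces of the final neighbourhood.
\<close>

lemma (in differentiable_atlas) openin_pair_box:
  fixes N :: "('a::real_normed_vector \<times> 'e \<times> 'e) set"
  assumes c: "c \<in> A" and N: "open N"
  shows "openin (manifold_topology (prod_atlas vec_atlas (prod_atlas A A)))
    {(h, v, v'). v \<in> fst c \<and> v' \<in> fst c \<and> (h, snd c v, snd c v') \<in> N}" (is "openin _ ?W")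
proof -
  have inj: "inj_on (snd k) (fst k)" if "k \<in> prod_atlas (vec_atlas :: ('a, 'a) atlas) (prod_atlas A A)" for k
    by (rule prod_chart_inj[OF _ prod_chart_inj[OF chart_inj chart_inj] that]) (auto simp: vec_atlas_def)
  have *: "openin (manifold_topology (prod_atlas (vec_atlas :: ('a, 'a) atlas) (prod_atlas A A))) W \<longleftrightarrow>
      W \<subseteq> points (prod_atlas vec_atlas (prod_atlas A A)) \<and>
      (\<forall>k\<in>prod_atlas vec_atlas (prod_atlas A A). open (snd k ` (W \<inter> fst k)))" for W
    by (rule openin_manifold_topology) (rule inj)
  show ?thesis
    unfolding *
  proof (intro conjI ballI)
    show "?W \<subseteq> points (prod_atlas vec_atlas (prod_atlas A A))"
      using c by (auto simp: points_prod intro: pointsI)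
    fix k :: "('a \<times> 'q \<times> 'q, 'a \<times> 'e \<times> 'e) chart" assume "k \<in> prod_atlas vec_atlas (prod_atlas A A)"
    then obtain d e where de: "d \<in> A" "e \<in> A"
      and k: "k = (UNIV \<times> fst d \<times> fst e, map_prod (\<lambda>x. x) (map_prod (snd d) (snd e)))"
      by (auto simp: prod_atlas_def vec_atlas_def)
    let ?S = "UNIV \<times> snd d ` (fst d \<inter> fst c) \<times> snd e ` (fst e \<inter> fst c)"
    let ?T = "\<lambda>p. (fst p, transition d c (fst (snd p)), transition e c (snd (snd p)))"
    have "open (?S \<inter> ?T -` N)"
    proof (rule continuous_open_preimage[OF _ _ N])
      show "continuous_on ?S ?T"
        by (intro continuous_on_Pair continuous_on_fst continuous_on_id
            continuous_on_compose2[OF transition_continuous[OF de(1) c]]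
            continuous_on_compose2[OF transition_continuous[OF de(2) c]] continuous_on_snd) auto
      show "open ?S" by (intro open_Times overlap_open de c) simp
    qed
    moreover have "?S \<inter> ?T -` N = snd k ` (?W \<inter> fst k)"
    proof (intro equalityI subsetI)
      fix z assume "z \<in> ?S \<inter> ?T -` N"
      then obtain h v v' where "z = (h, snd d v, snd e v')" "v \<in> fst d" "v \<in> fst c" "v' \<in> fst e" "v' \<in> fst c"
        "(h, snd c v, snd c v') \<in> N" using de by auto
      then show "z \<in> snd k ` (?W \<inter> fst k)"
        by (intro image_eqI[of _ _ "(h, v, v')"]) (simp_all add: k)
    next
      fix z assume "z \<in> snd k ` (?W \<inter> fst k)"
      then show "z \<in> ?S \<inter> ?T -` N" using de by (auto simp: k)
    qed
    ultimately show "open (snd k ` (?W \<inter> fst k))" by simp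
  qed
qed

section \<open>A regular forced mechanical system in one bundle chart\<close>

lemma smooth_mapD:
  assumes "smooth_map A B S F" "c \<in> A" "d \<in> B"
  shows "open (snd c ` {p \<in> S \<inter> fst c. F p \<in> fst d})"
    "smooth_on (snd c ` {p \<in> S \<inter> fst c. F p \<in> fst d}) (snd d \<circ> F \<circ> chart_inv c)"
proof -
  have *: "\<forall>c\<in>A. \<forall>d\<in>B. open (snd c ` {p \<in> S \<inter> fst c. F p \<in> fst d}) \<and>
      smooth_on (snd c ` {p \<in> S \<inter> fst c. F p \<in> fst d}) (snd d \<circ> F \<circ> chart_inv c)"
    using assms(1) unfolding smooth_map_def Let_def by (elim conjE)
  note ** = bspec[OF bspec[OF * assms(2)] assms(3)]
  show "open (snd c ` {p \<in> S \<inter> fst c. F p \<in> fst d})" using ** by (rule conjunct1)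
  show "smooth_on (snd c ` {p \<in> S \<inter> fst c. F p \<in> fst d}) (snd d \<circ> F \<circ> chart_inv c)" using ** by (rule conjunct2)
qed

lemma chart_at_vec [simp]: "chart_at vec_atlas x = (UNIV, \<lambda>x. x)"
  unfolding chart_at_def vec_atlas_def by (rule some_equality) auto

lemma chart_inv_id [simp]: "chart_inv (UNIV, \<lambda>x. x) = (\<lambda>x. x)"
  by (rule ext) (simp add: chart_inv_def inv_into_f_f)

lemma vec_chart_in [simp]: "(UNIV, \<lambda>x. x) \<in> vec_atlas"
  by (simp add: vec_atlas_def)

lemma prod_atlasI: "c \<in> A \<Longrightarrow> d \<in> B \<Longrightarrow> (fst c \<times> fst d, map_prod (snd c) (snd d)) \<in> prod_atlas A B"
  unfolding prod_atlas_def by blast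

lemma tangent_coord_vec [simp]: "tangent_coord vec_atlas c x = (\<lambda>w. w)" if "c \<in> vec_atlas"
proof -
  have "((\<lambda>x. x) has_derivative (\<lambda>w. w)) (at x)" by (rule has_derivative_ident)
  from frechet_derivative_at[OF this] show ?thesis
    using that unfolding tangent_coord_def chart_at_vec
    by (auto simp: transition_def vec_atlas_def comp_def)
qed

lemma Blinfun_frechet_derivative:
  assumes "(f has_derivative blinfun_apply f') (at x)"
  shows "Blinfun (frechet_derivative f (at x)) = f'"
  using frechet_derivative_at[OF assms] blinfun_apply_inverse[of f'] by simp

text \<open>
  One chart \<open>c\<close> of the configuration manifold is fixed, together with its bundle chart \<open>Tc\<close>.  Below, \<open>E2\<close> is the
  range of \<open>Tc\<close>, and \<open>G\<close>, \<open>V\<close>, \<open>l\<close>, \<open>\<phi>\<close> are the representatives of the flow, of the vector field, of the Lagrangian and of the force;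
  \<open>D\<close> collects the \<open>(t, z)\<close> for which the representative of the flow is meaningful, and \<open>\<Gamma>\<close> is its
  joint derivative in time and space, which carries the smoothness of the flow.
\<close>

locale chart_flow =
  fixes A :: "('q, 'e::banach) atlas"
    and L :: "'q \<times> 'e \<Rightarrow> real" and f :: "'q \<times> 'e \<Rightarrow> ('e \<times> 'e) \<Rightarrow>\<^sub>L real"
    and X :: "'q \<times> 'e \<Rightarrow> 'e \<times> 'e" and U :: "(real \<times> 'q \<times> 'e) set"
    and F :: "real \<Rightarrow> 'q \<times> 'e \<Rightarrow> 'q \<times> 'e" and c :: "('q, 'e) chart"
  assumes regular: "regular_fms A L f"
    and field: "lagrangian_vector_field A L f X"
    and flow: "is_flow (tangent_bundle A) X U F"
    and c_in: "c \<in> A"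
begin

abbreviation "TA \<equiv> tangent_bundle A"
abbreviation "Tc \<equiv> tangent_chart A c"
abbreviation "\<psi> \<equiv> chart_inv Tc"

definition E2 :: "('e \<times> 'e) set" where "E2 = snd Tc ` fst Tc"
definition G :: "real \<Rightarrow> 'e \<times> 'e \<Rightarrow> 'e \<times> 'e" where "G t z = snd Tc (F t (\<psi> z))"
definition D :: "(real \<times> 'e \<times> 'e) set" where
  "D = {(t, z). z \<in> E2 \<and> (t, \<psi> z) \<in> U \<and> F t (\<psi> z) \<in> fst Tc}"
definition \<Gamma> :: "real \<times> 'e \<times> 'e \<Rightarrow> (real \<times> 'e \<times> 'e) \<Rightarrow>\<^sub>L ('e \<times> 'e)" where
  "\<Gamma> p = Blinfun (frechet_derivative (\<lambda>(t, z). G t z) (at p))"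
definition G' :: "real \<Rightarrow> 'e \<times> 'e \<Rightarrow> ('e \<times> 'e) \<Rightarrow>\<^sub>L ('e \<times> 'e)" where
  "G' t z = Blinfun (frechet_derivative (G t) (at z))"
definition V :: "'e \<times> 'e \<Rightarrow> 'e \<times> 'e" where "V z = tangent_coord TA Tc (\<psi> z) (X (\<psi> z))"
definition l :: "'e \<times> 'e \<Rightarrow> real" where "l = L \<circ> \<psi>"
definition l' :: "'e \<times> 'e \<Rightarrow> ('e \<times> 'e) \<Rightarrow>\<^sub>L real" where "l' z = Blinfun (frechet_derivative l (at z))"
text \<open>
  This is the second component of the cotangent chart, so that continuity of \<open>\<phi>\<close> is part of the
  smoothness of the one-form.
\<close>

definition \<phi> :: "'e \<times> 'e \<Rightarrow> ('e \<times> 'e) \<Rightarrow>\<^sub>L real" where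
  "\<phi> z = f (\<psi> z) o\<^sub>L Blinfun (frechet_derivative (transition Tc (chart_at TA (\<psi> z))) (at z))"

lemma A_manifold: "smooth_manifold A"
  using regular by (simp add: regular_fms_def forced_mechanical_system_def)

sublocale A: differentiable_atlas A
  using A_manifold by (rule smooth_manifold_imp_differentiable_atlas)

sublocale TA: differentiable_atlas TA
  using A_manifold by (rule differentiable_atlas_tangent_bundle)

lemma Tc_in: "Tc \<in> TA"
  using c_in by (simp add: tangent_bundle_def)

lemma E2_open: "open E2"
  unfolding E2_def by (rule TA.chart_image_open[OF Tc_in])

lemma \<psi>_chart [simp]: "v \<in> fst Tc \<Longrightarrow> \<psi> (snd Tc v) = v"
  by (rule TA.chart_inv_chart[OF Tc_in])

lemma chart_in_E2: "v \<in> fst Tc \<Longrightarrow> snd Tc v \<in> E2"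
  unfolding E2_def by (rule imageI)

lemma E2E:
  assumes "z \<in> E2" obtains v where "v \<in> fst Tc" "z = snd Tc v"
  using assms unfolding E2_def by blast

lemma \<psi>_in: "z \<in> E2 \<Longrightarrow> \<psi> z \<in> fst Tc"
  by (erule E2E) (simp only: \<psi>_chart)

lemma chart_\<psi>: "z \<in> E2 \<Longrightarrow> snd Tc (\<psi> z) = z"
  by (erule E2E) (simp only: \<psi>_chart)

lemma in_points: "v \<in> fst Tc \<Longrightarrow> v \<in> points TA"
  by (rule pointsI[OF Tc_in])

lemma D_E2: "(t, z) \<in> D \<Longrightarrow> z \<in> E2" "(t, z) \<in> D \<Longrightarrow> G t z \<in> E2"
  "(t, z) \<in> D \<Longrightarrow> (t, \<psi> z) \<in> U" "(t, z) \<in> D \<Longrightarrow> F t (\<psi> z) \<in> fst Tc"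
  "(t, z) \<in> D \<Longrightarrow> \<psi> (G t z) = F t (\<psi> z)"
  unfolding D_def G_def by (simp_all add: chart_in_E2)

lemma D_open: "open D"
  and \<Gamma>_deriv: "p \<in> D \<Longrightarrow> ((\<lambda>(t, z). G t z) has_derivative \<Gamma> p) (at p)"
  and \<Gamma>_cont: "continuous_on D \<Gamma>"
proof -
  let ?k = "(UNIV \<times> fst Tc, map_prod (\<lambda>x. x) (snd Tc)) :: (real \<times> 'q \<times> 'e, real \<times> 'e \<times> 'e) chart"
  have k: "?k \<in> prod_atlas vec_atlas TA" using prod_atlasI[OF vec_chart_in Tc_in] by simp
  have inj: "inj_on (snd ?k) (fst ?k)"
    using map_prod_inj_on[of "\<lambda>x. x" UNIV, OF _ TA.chart_inj[OF Tc_in]] by simp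
  have k_inv: "chart_inv ?k (t, z) = (t, \<psi> z)" if "z \<in> E2" for t z
    using inv_into_f_f[OF inj, of "(t, \<psi> z)"] \<psi>_in[OF that] chart_\<psi>[OF that]
    by (simp add: chart_inv_def)
  have sm: "smooth_map (prod_atlas vec_atlas TA) TA U (\<lambda>(t, p). F t p)"
    using flow by (simp add: is_flow_def)
  have "snd ?k ` {p \<in> U \<inter> fst ?k. (case p of (t, p) \<Rightarrow> F t p) \<in> fst Tc} = D" (is "?W = D")
  proof (intro equalityI subsetI)
    fix y assume "y \<in> ?W"
    then obtain t v where "y = (t, snd Tc v)" "(t, v) \<in> U" "v \<in> fst Tc" "F t v \<in> fst Tc" by auto
    then show "y \<in> D" unfolding D_def by (auto intro: chart_in_E2)
  next
    fix y assume "y \<in> D"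
    then obtain t z where y: "y = (t, z)" "(t, z) \<in> D" by (cases y) auto
    then show "y \<in> ?W"
      using D_E2[OF y(2)] chart_\<psi>[of z] \<psi>_in[of z] by (intro image_eqI[of _ _ "(t, \<psi> z)"]) auto
  qed
  with smooth_mapD[OF sm k Tc_in] have D: "open D" "smooth_on D (snd Tc \<circ> (\<lambda>(t, p). F t p) \<circ> chart_inv ?k)"
    by simp_all
  show "open D" by fact
  obtain M where M: "\<forall>x\<in>D. ((snd Tc \<circ> (\<lambda>(t, p). F t p) \<circ> chart_inv ?k) has_derivative blinfun_apply (M x)) (at x)"
    "continuous_on D M" using smooth_on_imp_C1[OF D(2)] by (elim exE conjE)
  have deriv: "((\<lambda>(t, z). G t z) has_derivative blinfun_apply (M p)) (at p)" if "p \<in> D" for p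
  proof (rule has_derivative_transform_within_open[OF bspec[OF M(1), OF that] D(1) that])
    fix p assume p: "p \<in> D"
    obtain t z where tz: "p = (t, z)" by (cases p)
    show "(snd Tc \<circ> (\<lambda>(t, p). F t p) \<circ> chart_inv ?k) p = (case p of (t, z) \<Rightarrow> G t z)"
      using k_inv[OF D_E2(1), of t z t] p by (simp add: tz G_def)
  qed
  have eq: "\<Gamma> p = M p" if "p \<in> D" for p
    unfolding \<Gamma>_def by (rule Blinfun_frechet_derivative[OF deriv[OF that]])
  show "((\<lambda>(t, z). G t z) has_derivative \<Gamma> p) (at p)" if "p \<in> D" for p
    using deriv[OF that] eq[OF that] by simp
  show "continuous_on D \<Gamma>" by (rule continuous_on_eq[OF M(2)]) (simp add: eq)
qed

lemma G_cont: "continuous_on D (\<lambda>(t, z). G t z)"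
  by (rule continuous_at_imp_continuous_on, rule ballI, rule has_derivative_continuous, rule \<Gamma>_deriv)

lemma G_deriv: "(t, z) \<in> D \<Longrightarrow> (G t has_derivative G' t z) (at z)"
  and G'_eq: "(t, z) \<in> D \<Longrightarrow> G' t z = \<Gamma> (t, z) o\<^sub>L Blinfun (Pair 0)"
proof -
  assume tz: "(t, z) \<in> D"
  have j: "blinfun_apply (Blinfun (Pair 0)) = (\<lambda>w::'e \<times> 'e. (0::real, w))"
    by (simp add: bounded_linear_Blinfun_apply bounded_linear_Pair bounded_linear_ident bounded_linear_zero)
  have "((\<lambda>z. (t, z)) has_derivative (\<lambda>w. (0, w))) (at z)"
    by (intro has_derivative_Pair has_derivative_const has_derivative_ident)
  from has_derivative_compose[OF this \<Gamma>_deriv[OF tz]]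
  have 1: "(G t has_derivative (\<Gamma> (t, z) o\<^sub>L Blinfun (Pair 0))) (at z)"
    by (simp add: blinfun_compose.rep_eq j comp_def)
  show "G' t z = \<Gamma> (t, z) o\<^sub>L Blinfun (Pair 0)"
    unfolding G'_def by (rule Blinfun_frechet_derivative[OF 1])
  with 1 show "(G t has_derivative G' t z) (at z)" by simp
qed

lemma G'_cont: "continuous_on D (\<lambda>(t, z). G' t z)"
proof -
  have "continuous_on D (\<lambda>p. \<Gamma> p o\<^sub>L Blinfun (Pair 0))"
    by (intro continuous_intros \<Gamma>_cont)
  then show ?thesis by (rule continuous_on_eq) (auto simp: G'_eq)
qed

text \<open>
  The integral curve condition, read in the chart instead of the preferred charts along the curve.
\<close>

lemma G_time_deriv:
  assumes tz: "(t, z) \<in> D"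
  shows "((\<lambda>t. G t z) has_vector_derivative V (G t z)) (at t)"
proof -
  have "((\<lambda>t. (t, z)) has_derivative (\<lambda>h. (h, 0))) (at t)"
    by (intro has_derivative_Pair has_derivative_const has_derivative_ident)
  from has_derivative_compose[OF this \<Gamma>_deriv[OF tz]]
  have d: "((\<lambda>t. G t z) has_derivative (\<lambda>h. \<Gamma> (t, z) (h, 0))) (at t)" by simp
  let ?N = "(\<lambda>t. (t, z)) -` D"
  have N: "open ?N" by (intro open_vimage D_open continuous_intros)
  let ?q = "\<lambda>t. F t (\<psi> z)"
  have p: "\<psi> z \<in> points TA" by (intro in_points \<psi>_in D_E2(1)[OF tz])
  have "tangent_coord TA Tc (?q t) (tangent_map vec_atlas TA ?q t 1) =
     \<Gamma> (t, z) (tangent_coord vec_atlas (UNIV, \<lambda>x. x) t 1, 0)"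
  proof (rule tangent_map_coord[OF differentiable_atlas_vec TA.differentiable_atlas_axioms, where N = ?N])
    show "((\<lambda>x. snd Tc (F (chart_inv (UNIV, \<lambda>x. x) x) (\<psi> z))) has_derivative (\<lambda>w. \<Gamma> (t, z) (w, 0)))
      (at (snd (UNIV, \<lambda>x. x) t))" using d by (simp add: G_def)
  qed (use N tz D_E2 Tc_in in auto)
  moreover have "tangent_map vec_atlas TA ?q t 1 = X (?q t)"
  proof -
    have "velocity TA ?q t = (?q t, X (?q t))"
      using flow p D_E2(3)[OF tz] by (auto simp: is_flow_def integral_curve_def)
    then show ?thesis by (simp add: velocity_def)
  qed
  ultimately have "\<Gamma> (t, z) (1, 0) = V (G t z)"
    using D_E2(5)[OF tz] by (simp add: V_def)
  then have "(\<lambda>h. \<Gamma> (t, z) (h, 0)) = (\<lambda>h. h *\<^sub>R V (G t z))"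
    using blinfun.scaleR_right[of "\<Gamma> (t, z)" _ "(1, 0)"] by (simp add: fun_eq_iff)
  with d show ?thesis by (simp only: has_vector_derivative_def)
qed

lemma V_C1:
  "\<exists>V'. (\<forall>z\<in>E2. (V has_derivative blinfun_apply (V' z)) (at z)) \<and> continuous_on E2 V'"
proof -
  let ?d = "tangent_chart TA Tc"
  have sm: "smooth_map TA (tangent_bundle TA) (points TA) (\<lambda>p. (p, X p))"
    using field by (simp add: lagrangian_vector_field_def smooth_vector_field_def)
  have d: "?d \<in> tangent_bundle TA" using Tc_in by (simp add: tangent_bundle_def[of TA])
  have W: "snd Tc ` {p \<in> points TA \<inter> fst Tc. (p, X p) \<in> fst ?d} = E2"
    unfolding E2_def using in_points by (auto simp: fst_tangent_chart[of TA])
  obtain M where M: "\<forall>z\<in>E2. ((snd ?d \<circ> (\<lambda>p. (p, X p)) \<circ> \<psi>) has_derivative blinfun_apply (M z)) (at z)"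
    "continuous_on E2 M"
    using smooth_on_imp_C1[OF smooth_mapD(2)[OF sm Tc_in d, unfolded W]] by (elim exE conjE)
  show ?thesis
  proof (intro exI conjI ballI)
    fix z assume z: "z \<in> E2"
    have "((\<lambda>z. snd ((snd ?d \<circ> (\<lambda>p. (p, X p)) \<circ> \<psi>) z)) has_derivative (\<lambda>w. snd (M z w))) (at z)"
      by (rule has_derivative_snd[OF bspec[OF M(1), OF z]])
    then show "(V has_derivative blinfun_apply (Blinfun snd o\<^sub>L M z)) (at z)"
      by (rule has_derivative_eq_rhs[OF has_derivative_transform_within_open[OF _ E2_open z]])
        (simp_all add: V_def snd_tangent_chart[of TA] fun_eq_iff bounded_linear_Blinfun_apply bounded_linear_snd)
  next
    show "continuous_on E2 (\<lambda>z. Blinfun snd o\<^sub>L M z)" by (intro continuous_intros M)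
  qed
qed

text \<open>
  In bundle coordinates the projection to the configuration manifold is \<open>fst\<close>, and so is its derivative.
\<close>

lemma projection_coord:
  assumes v: "v \<in> fst Tc"
  shows "tangent_coord A c (fst v) (tangent_map TA A fst v w) = fst (tangent_coord TA Tc v w)"
proof (rule tangent_map_coord[OF TA.differentiable_atlas_axioms A.differentiable_atlas_axioms, where N = E2])
  have eq: "snd c (fst (\<psi> z)) = fst z" if "z \<in> E2" for z
    using chart_\<psi>[OF that] by (cases "\<psi> z") (auto simp: snd_tangent_chart)
  show "((\<lambda>x. snd c (fst (\<psi> x))) has_derivative fst) (at (snd Tc v))"
    by (rule has_derivative_transform_within_open[OF has_derivative_fst[OF has_derivative_ident] E2_open chart_in_E2[OF v]])
      (simp add: eq)
  show "fst (\<psi> x) \<in> fst c" if "x \<in> E2" for x using \<psi>_in[OF that] by (auto simp: fst_tangent_chart)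
qed (use v Tc_in c_in E2_open chart_in_E2[OF v] in \<open>auto simp: fst_tangent_chart\<close>)

lemma V_second_order:
  assumes z: "z \<in> E2"
  shows "fst (V z) = snd z"
proof -
  define v where "v = \<psi> z"
  have v: "v \<in> fst Tc" and vz: "snd Tc v = z" using \<psi>_in[OF z] chart_\<psi>[OF z] by (auto simp: v_def)
  have "tangent_coord A c (fst v) (tangent_map TA A fst v (X v)) = fst (tangent_coord TA Tc v (X v))"
    by (rule projection_coord[OF v])
  moreover have "tangent_map TA A fst v (X v) = snd v"
    using field in_points[OF v] by (auto simp: lagrangian_vector_field_def second_order_def)
  moreover have "tangent_coord A c (fst v) (snd v) = snd z"
    using vz by (cases v) (auto simp: snd_tangent_chart)
  ultimately show ?thesis by (simp add: V_def v_def)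
qed

lemma l_deriv: "z \<in> E2 \<Longrightarrow> (l has_derivative l' z) (at z)"
  and l'_cont: "continuous_on E2 l'"
proof -
  have sm: "smooth_map TA vec_atlas (points TA) L"
    using regular by (simp add: regular_fms_def forced_mechanical_system_def)
  have W: "snd Tc ` {p \<in> points TA \<inter> fst Tc. L p \<in> fst (UNIV :: real set, \<lambda>x. x)} = E2"
    unfolding E2_def using in_points by (auto)
  obtain M where M: "\<forall>z\<in>E2. ((snd (UNIV :: real set, \<lambda>x. x) \<circ> L \<circ> \<psi>) has_derivative blinfun_apply (M z)) (at z)"
    "continuous_on E2 M"
    using smooth_on_imp_C1[OF smooth_mapD(2)[OF sm Tc_in vec_chart_in, unfolded W]] by (elim exE conjE)
  have lM: "(l has_derivative blinfun_apply (M z)) (at z)" if "z \<in> E2" for z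
    using bspec[OF M(1), OF that] by (simp add: l_def comp_def)
  have eq: "l' z = M z" if "z \<in> E2" for z
    unfolding l'_def by (rule Blinfun_frechet_derivative[OF lM[OF that]])
  show "z \<in> E2 \<Longrightarrow> (l has_derivative l' z) (at z)" using lM eq by simp
  show "continuous_on E2 l'" by (rule continuous_on_eq[OF M(2)]) (simp add: eq)
qed

lemma \<phi>_apply:
  assumes v: "v \<in> fst Tc"
  shows "\<phi> (snd Tc v) (tangent_coord TA Tc v w) = f v w"
proof -
  let ?k = "chart_at TA v"
  have "bounded_linear (frechet_derivative (transition Tc ?k) (at (snd Tc v)))"
    using chart_at_in[OF in_points[OF v]] v Tc_in
    by (intro has_derivative_bounded_linear[OF TA.transition_deriv]) auto
  then show ?thesis
    using TA.tangent_coord_inverse(1)[OF Tc_in v] v by (simp add: \<phi>_def bounded_linear_Blinfun_apply)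
qed

lemma \<phi>_cont: "continuous_on E2 \<phi>"
proof -
  let ?d = "cotangent_chart TA Tc"
  have sm: "smooth_map TA (cotangent_bundle TA) (points TA) (\<lambda>p. (p, f p))"
    using regular by (simp add: regular_fms_def forced_mechanical_system_def smooth_one_form_def)
  have d: "?d \<in> cotangent_bundle TA" using Tc_in by (simp add: cotangent_bundle_def)
  have W: "snd Tc ` {p \<in> points TA \<inter> fst Tc. (p, f p) \<in> fst ?d} = E2"
    unfolding E2_def using in_points by (auto simp: cotangent_chart_def)
  have "Ck_on 0 E2 (snd ?d \<circ> (\<lambda>p. (p, f p)) \<circ> \<psi>)"
    using smooth_mapD(2)[OF sm Tc_in d] unfolding W by (simp add: smooth_on_def del: Ck_on.simps)
  then have "continuous_on E2 (\<lambda>z. snd ((snd ?d \<circ> (\<lambda>p. (p, f p)) \<circ> \<psi>) z))"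
    by (intro continuous_on_snd) simp
  then show ?thesis
    by (rule continuous_on_eq) (simp add: cotangent_chart_def \<phi>_def chart_\<psi>)
qed

end

lemma prod_chart_inv:
  assumes "inj_on (snd c) (fst c)" "inj_on (snd d) (fst d)" "p \<in> fst c" "q \<in> fst d"
  shows "chart_inv (fst c \<times> fst d, map_prod (snd c) (snd d)) (snd c p, snd d q) = (p, q)"
  using inv_into_f_f[OF map_prod_inj_on[OF assms(1,2)], of "(p, q)"] assms(3,4) by (simp add: chart_inv_def)

text \<open>
  Near the image point the representative of the map is a left inverse of the representative of its
  inverse, taken in that order; differentiating this identity provides a preimage of \<open>w\<close>.
\<close>

lemma diffeo_on_derivative_surj:
  assumes AB: "\<And>c. c \<in> A \<Longrightarrow> inj_on (snd c) (fst c)" "\<And>c. c \<in> B \<Longrightarrow> inj_on (snd c) (fst c)"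
    and diffeo: "diffeo_on A B S T \<Phi>" and c: "c \<in> A" "p \<in> fst c" and d: "d \<in> B" "\<Phi> p \<in> fst d" and p: "p \<in> S"
    and D: "((snd d \<circ> \<Phi> \<circ> chart_inv c) has_derivative D) (at (snd c p))"
  shows "\<exists>u. D u = w"
proof -
  let ?\<Psi> = "inv_into S \<Phi>"
  let ?W = "snd d ` {q \<in> T \<inter> fst d. ?\<Psi> q \<in> fst c}"
  let ?k = "snd c \<circ> ?\<Psi> \<circ> chart_inv d"
  have bij: "bij_betw \<Phi> S T" and sm: "smooth_map B A T ?\<Psi>" using diffeo by (auto simp: diffeo_on_def)
  have inv_c: "chart_inv c (snd c x) = x" if "x \<in> fst c" for x
    using inv_into_f_f[OF AB(1)[OF c(1)] that] by (simp add: chart_inv_def)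
  have inv_d: "chart_inv d (snd d x) = x" if "x \<in> fst d" for x
    using inv_into_f_f[OF AB(2)[OF d(1)] that] by (simp add: chart_inv_def)
  have \<Psi>: "?\<Psi> (\<Phi> p) = p" "\<Phi> p \<in> T" using bij p by (auto simp: bij_betw_def)
  have W: "open ?W" "smooth_on ?W ?k" using smooth_mapD[OF sm d(1) c(1)] by auto
  have y: "snd d (\<Phi> p) \<in> ?W" using \<Psi> d c by auto
  obtain M where "\<forall>x\<in>?W. (?k has_derivative blinfun_apply (M x)) (at x)"
    using smooth_on_imp_C1[OF W(2)] by blast
  from bspec[OF this y] have k: "(?k has_derivative M (snd d (\<Phi> p))) (at (snd d (\<Phi> p)))" .
  have "?k (snd d (\<Phi> p)) = snd c p" using \<Psi> by (simp add: inv_d[OF d(2)])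
  with D have D: "((snd d \<circ> \<Phi> \<circ> chart_inv c) has_derivative D) (at (?k (snd d (\<Phi> p))))" by simp
  have "((\<lambda>x. x) has_derivative (\<lambda>w. D (M (snd d (\<Phi> p)) w))) (at (snd d (\<Phi> p)))"
  proof (rule has_derivative_transform_within_open[OF has_derivative_compose[OF k D] W(1) y])
    fix x assume "x \<in> ?W"
    then obtain q where q: "x = snd d q" "q \<in> T" "q \<in> fst d" "?\<Psi> q \<in> fst c" by auto
    have "\<Phi> (?\<Psi> q) = q" using bij q(2) by (simp add: bij_betw_def f_inv_into_f)
    then show "(snd d \<circ> \<Phi> \<circ> chart_inv c) (?k x) = x"
      using q by (simp add: inv_c inv_d)
  qed
  from has_derivative_unique[OF this has_derivative_ident] show ?thesis by metis
qed

context chart_flow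
begin

lemma fst_tangent_chart_apply: "fst (snd Tc v) = snd c (fst v)"
  by (simp add: snd_tangent_chart split: prod.splits)

lemma \<phi>_eq:
  assumes "z \<in> E2"
  shows "\<phi> z w = f (\<psi> z) (frechet_derivative (transition Tc (chart_at TA (\<psi> z))) (at z) w)"
proof -
  have v: "\<psi> z \<in> fst Tc" "snd Tc (\<psi> z) = z" using \<psi>_in chart_\<psi> assms by auto
  have "bounded_linear (frechet_derivative (transition Tc (chart_at TA (\<psi> z))) (at z))"
    using chart_at_in[OF in_points[OF v(1)]] v Tc_in TA.transition_deriv[of Tc "chart_at TA (\<psi> z)" "\<psi> z"]
    by (auto intro: has_derivative_bounded_linear)
  then show ?thesis by (simp add: \<phi>_def bounded_linear_Blinfun_apply)
qed

text \<open>
  \<open>(0, e)\<close> is the representative of a vertical vector.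
\<close>

lemma \<phi>_horizontal:
  assumes z: "z \<in> E2"
  shows "\<phi> z (0, e) = 0"
proof -
  define v where "v = \<psi> z"
  have v: "v \<in> fst Tc" "snd Tc v = z" using \<psi>_in[OF z] chart_\<psi>[OF z] by (auto simp: v_def)
  have v1: "fst v \<in> fst c" using v by (auto simp: fst_tangent_chart)
  define w where "w = frechet_derivative (transition Tc (chart_at TA v)) (at z) (0, e)"
  have w: "tangent_coord TA Tc v w = (0, e)"
    using TA.tangent_coord_inverse(2)[OF Tc_in v(1), of "(0, e)"] by (simp add: w_def v)
  have "tangent_map TA A fst v w = 0"
    using projection_coord[OF v(1), of w] A.tangent_coord_eq_0_iff[OF c_in v1] by (simp add: w)
  moreover have "horizontal A f" using regular by (simp add: regular_fms_def forced_mechanical_system_def)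
  ultimately have "f v w = 0" using in_points[OF v(1)] unfolding horizontal_def by blast
  then show ?thesis using \<phi>_apply[OF v(1), of w] by (simp add: w v)
qed

text \<open>
  The flow line through \<open>\<psi> z\<close> is the velocity curve of a trajectory, whose equations of motion are
  transcribed into the chart.
\<close>

lemma euler_lagrange:
  assumes tz: "(t, z) \<in> D"
  shows "((\<lambda>s. l' (G s z) (0, e)) has_real_derivative l' (G t z) (e, 0) + \<phi> (G t z) (e, 0)) (at t)"
proof -
  let ?I = "{t. (t, \<psi> z) \<in> U}" and ?\<gamma> = "\<lambda>t. F t (\<psi> z)"
  have p: "\<psi> z \<in> points TA" by (intro in_points \<psi>_in D_E2(1)[OF tz])
  have "integral_curve TA X ?I ?\<gamma>" using flow p by (auto simp: is_flow_def)
  then obtain q where q: "fms_trajectory A L f ?I q" and \<gamma>: "\<And>t. t \<in> ?I \<Longrightarrow> ?\<gamma> t = velocity A q t"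
    using field by (auto simp: lagrangian_vector_field_def)
  let ?y = "\<lambda>s. snd Tc (velocity A q s)"
  have y: "velocity A q s = F s (\<psi> z)" "?y s = G s z" "G s z \<in> E2" if "(s, z) \<in> D" for s
    using D_E2[OF that] \<gamma>[of s] by (auto simp: G_def)
  have l'_frechet: "frechet_derivative (L \<circ> \<psi>) (at x) = l' x" if "x \<in> E2" for x
    using frechet_derivative_at[OF l_deriv[OF that]] by (simp add: l_def)
  have tI: "t \<in> ?I" using D_E2[OF tz] by simp
  have "velocity A q t \<in> fst Tc" using D_E2(4)[OF tz] y(1)[OF tz] by simp
  then have qt: "q t \<in> fst c" by (simp add: velocity_def fst_tangent_chart)
  have map_\<psi>: "tangent_map vec_atlas TA \<psi> x = frechet_derivative (transition Tc (chart_at TA (\<psi> x))) (at x)" for x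
    by (simp add: tangent_map_def transition_def comp_def)
  have "((\<lambda>s. frechet_derivative (L \<circ> \<psi>) (at (?y s)) (0, e)) has_real_derivative
      frechet_derivative (L \<circ> \<psi>) (at (?y t)) (e, 0) + f (velocity A q t) (tangent_map vec_atlas TA \<psi> (?y t) (e, 0))) (at t)"
    using q tI qt c_in unfolding fms_trajectory_def Let_def by blast
  then have "((\<lambda>s. frechet_derivative (L \<circ> \<psi>) (at (?y s)) (0, e)) has_real_derivative
      l' (G t z) (e, 0) + \<phi> (G t z) (e, 0)) (at t)"
    using y[OF tz] D_E2(5)[OF tz] by (simp add: l'_frechet map_\<psi> \<phi>_eq)
  then show ?thesis
  proof (rule has_field_derivative_transform_within_open[where S = "(\<lambda>s. (s, z)) -` D"])
    show "open ((\<lambda>s. (s, z)) -` D)" by (intro open_vimage D_open continuous_intros)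
  qed (use tz y in \<open>auto simp: l'_frechet\<close>)
qed

lemma zero_in_D: "z \<in> E2 \<Longrightarrow> (0, z) \<in> D"
  and G_0: "z \<in> E2 \<Longrightarrow> G 0 z = z"
proof -
  assume z: "z \<in> E2"
  have "\<psi> z \<in> points TA" by (intro in_points \<psi>_in z)
  then have "(0, \<psi> z) \<in> U" "F 0 (\<psi> z) = \<psi> z" using flow by (auto simp: is_flow_def)
  then show "(0, z) \<in> D" "G 0 z = z" using z \<psi>_in[OF z] chart_\<psi>[OF z] by (auto simp: D_def G_def)
qed

text \<open>
  In the chart, \<open>t \<mapsto> e + t w\<close> becomes a straight line in the velocity component.
\<close>

lemma legendre_chart:
  assumes v: "v \<in> fst Tc"
  shows "legendre L v = (fst v, Blinfun (\<lambda>w. l' (snd Tc v) (0, tangent_coord A c (fst v) w)))"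
proof -
  obtain q e where qe: "v = (q, e)" by (cases v)
  have q: "q \<in> fst c" using v by (simp add: qe fst_tangent_chart)
  let ?tc = "tangent_coord A c q"
  have lin: "linear ?tc" by (rule bounded_linear.linear[OF A.tangent_coord_linear[OF c_in q]])
  have "deriv (\<lambda>t. L (q, e + t *\<^sub>R w)) 0 = l' (snd Tc v) (0, ?tc w)" for w
  proof (rule DERIV_imp_deriv)
    have L: "L (q, e + t *\<^sub>R w) = l (snd Tc v + t *\<^sub>R (0, ?tc w))" for t
    proof -
      have "snd Tc (q, e + t *\<^sub>R w) = snd Tc v + t *\<^sub>R (0, ?tc w)"
        by (simp add: snd_tangent_chart qe linear_add[OF lin] linear_scale[OF lin])
      moreover have "(q, e + t *\<^sub>R w) \<in> fst Tc" using q by (simp add: fst_tangent_chart)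
      ultimately show ?thesis using \<psi>_chart[of "(q, e + t *\<^sub>R w)"] by (simp add: l_def)
    qed
    have "((\<lambda>t. snd Tc v + t *\<^sub>R (0, ?tc w)) has_derivative (\<lambda>t. t *\<^sub>R (0, ?tc w))) (at 0)"
      by (auto intro!: derivative_eq_intros)
    moreover have "(l has_derivative l' (snd Tc v)) (at (snd Tc v + 0 *\<^sub>R (0, ?tc w)))"
      using l_deriv[OF chart_in_E2[OF v]] by (simp only: scaleR_zero_left add_0_right)
    ultimately have "((\<lambda>t. l (snd Tc v + t *\<^sub>R (0, ?tc w))) has_derivative (\<lambda>t. l' (snd Tc v) (t *\<^sub>R (0, ?tc w)))) (at 0)"
      by (rule has_derivative_compose)
    then show "((\<lambda>t. L (q, e + t *\<^sub>R w)) has_real_derivative l' (snd Tc v) (0, ?tc w)) (at 0)"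
      unfolding L has_field_derivative_def
      by (rule has_derivative_eq_rhs) (simp add: fun_eq_iff blinfun.scaleR_right mult.commute del: scaleR_Pair)
  qed
  then show ?thesis by (simp add: legendre_def qe)
qed

lemma legendre_eqI:
  assumes v: "v \<in> fst Tc" "v' \<in> fst Tc" and fst_eq: "fst (snd Tc v) = fst (snd Tc v')"
    and l'_eq: "\<And>e. l' (snd Tc v) (0, e) = l' (snd Tc v') (0, e)"
  shows "legendre L v = legendre L v'"
proof -
  have "fst v \<in> fst c" "fst v' \<in> fst c" using v by (auto simp: fst_tangent_chart)
  moreover have "snd c (fst v) = snd c (fst v')" using fst_eq by (auto simp: snd_tangent_chart split: prod.splits)
  ultimately have "fst v = fst v'" using inj_onD[OF A.chart_inj[OF c_in]] by blast
  then show ?thesis by (simp add: legendre_chart v l'_eq)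
qed

lemma base_map_coord:
  assumes v: "v \<in> fst Tc" and D: "(t, snd Tc v) \<in> D"
  shows "tangent_coord A c (fst (F t v)) (tangent_map TA A (\<lambda>v. fst (F t v)) v w) =
    fst (G' t (snd Tc v) (tangent_coord TA Tc v w))"
proof (rule tangent_map_coord[OF TA.differentiable_atlas_axioms A.differentiable_atlas_axioms Tc_in v c_in])
  let ?N = "(\<lambda>z. (t, z)) -` D"
  show N: "open ?N" by (intro open_vimage D_open continuous_intros)
  show "snd Tc v \<in> ?N" using D by simp
  show "fst (F t v) \<in> fst c" using D_E2(4)[OF D] v by (auto simp: fst_tangent_chart)
  show "fst (F t (\<psi> x)) \<in> fst c" if "x \<in> ?N" for x using D_E2(4)[of t x] that by (auto simp: fst_tangent_chart)
  show "((\<lambda>x. snd c (fst (F t (\<psi> x)))) has_derivative (\<lambda>w. fst (G' t (snd Tc v) w))) (at (snd Tc v))"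
    by (rule has_derivative_transform_within_open[OF has_derivative_fst[OF G_deriv[OF D]] N])
      (use D in \<open>auto simp: G_def snd_tangent_chart split: prod.splits\<close>)
qed

lemma flow_map_coord:
  assumes v: "v \<in> fst Tc" and D: "(t, snd Tc v) \<in> D"
  shows "tangent_coord TA Tc (F t v) (tangent_map TA TA (F t) v w) = G' t (snd Tc v) (tangent_coord TA Tc v w)"
proof (rule tangent_map_coord[OF TA.differentiable_atlas_axioms TA.differentiable_atlas_axioms Tc_in v Tc_in])
  let ?N = "(\<lambda>z. (t, z)) -` D"
  show N: "open ?N" by (intro open_vimage D_open continuous_intros)
  show "snd Tc v \<in> ?N" using D by simp
  show "F t v \<in> fst Tc" using D_E2(4)[OF D] v by simp
  show "F t (\<psi> x) \<in> fst Tc" if "x \<in> ?N" for x using D_E2(4)[of t x] that by simp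
  show "((\<lambda>x. snd Tc (F t (\<psi> x))) has_derivative G' t (snd Tc v)) (at (snd Tc v))"
    using G_deriv[OF D] by (simp add: G_def[abs_def])
qed

lemma force_coord:
  assumes v: "v \<in> fst Tc" and D: "(t, snd Tc v) \<in> D"
  shows "f (F t v) (tangent_map TA TA (F t) v w) = \<phi> (G t (snd Tc v)) (G' t (snd Tc v) (tangent_coord TA Tc v w))"
proof -
  have "F t v \<in> fst Tc" using D_E2(4)[OF D] v by simp
  from \<phi>_apply[OF this, of "tangent_map TA TA (F t) v w"] show ?thesis
    using v by (simp add: flow_map_coord[OF v D] G_def)
qed

text \<open>
  The derivative of \<open>(h, v) \<mapsto> (h, \<partial>\<^sup>- v, \<partial>\<^sup>+ v)\<close> attains \<open>(0, wm, wp)\<close>.  As the map preserves the time,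
  the preimage has time component 0, so it is a variation at fixed \<open>h\<close>.
\<close>

lemma boundary_derivative_surj:
  assumes adm: "admissible_domain A U F a0 \<alpha>p \<alpha>m UE"
    and hv: "(h, v) \<in> UE" "h \<noteq> 0" "v \<in> fst Tc"
    and D: "(\<alpha>m h, snd Tc v) \<in> D" "(\<alpha>p h, snd Tc v) \<in> D"
  shows "\<exists>w. fst (G' (\<alpha>m h) (snd Tc v) w) = wm \<and> fst (G' (\<alpha>p h) (snd Tc v) w) = wp"
proof -
  let ?P = "prod_atlas vec_atlas TA :: (real \<times> 'q \<times> 'e, real \<times> 'e \<times> 'e) atlas"
    and ?R = "prod_atlas vec_atlas (prod_atlas A A) :: (real \<times> 'q \<times> 'q, real \<times> 'e \<times> 'e) atlas"
  let ?S = "UE - {0} \<times> points TA" and ?\<Phi> = "exact_bd_tilde F \<alpha>p \<alpha>m"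
  let ?k = "(UNIV \<times> fst Tc, map_prod (\<lambda>x. x) (snd Tc)) :: (real \<times> 'q \<times> 'e, real \<times> 'e \<times> 'e) chart"
  let ?m = "(UNIV \<times> fst c \<times> fst c, map_prod (\<lambda>x. x) (map_prod (snd c) (snd c))) :: (real \<times> 'q \<times> 'q, real \<times> 'e \<times> 'e) chart"
  let ?z = "snd Tc v" let ?x = "(h, ?z)"
  let ?H = "snd ?m \<circ> ?\<Phi> \<circ> chart_inv ?k"
  have diffeo: "diffeo_on ?P ?R ?S (?\<Phi> ` UE - {0} \<times> (points A \<times> points A)) ?\<Phi>"
    using adm by (simp add: admissible_domain_def)
  have k: "?k \<in> ?P" using prod_atlasI[OF vec_chart_in Tc_in] by simp
  have m: "?m \<in> ?R" using prod_atlasI[OF vec_chart_in prod_atlasI[OF c_in c_in]] by simp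
  have k_inv: "chart_inv ?k (t, z) = (t, \<psi> z)" if "z \<in> E2" for t z
    using prod_chart_inv[of "(UNIV, \<lambda>x. x)" Tc t "\<psi> z"] TA.chart_inj[OF Tc_in] \<psi>_in[OF that] chart_\<psi>[OF that] by simp
  have \<Phi>_eq: "?\<Phi> (t, v) = (t, fst (F (\<alpha>m t) v), fst (F (\<alpha>p t) v))" for t v
    by (simp add: exact_bd_tilde_def exact_bd_pair_def exact_bd_def exact_psi_def)
  have H_eq: "?H (t, z) = (t, snd c (fst (F (\<alpha>m t) (\<psi> z))), snd c (fst (F (\<alpha>p t) (\<psi> z))))" if "z \<in> E2" for t z
    by (simp add: k_inv[OF that] \<Phi>_eq)
  have \<Phi>_m: "?\<Phi> (h, v) \<in> fst ?m"
    using D_E2(4)[OF D(1)] D_E2(4)[OF D(2)] hv(3) by (auto simp: \<Phi>_eq fst_tangent_chart)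
  have sm: "smooth_map ?P ?R ?S ?\<Phi>" using diffeo by (simp add: diffeo_on_def)
  let ?W = "snd ?k ` {p \<in> ?S \<inter> fst ?k. ?\<Phi> p \<in> fst ?m}"
  have xW: "?x \<in> ?W" using hv \<Phi>_m by (intro image_eqI[of _ _ "(h, v)"]) auto
  obtain M where "\<forall>x\<in>?W. (?H has_derivative blinfun_apply (M x)) (at x)"
    using smooth_on_imp_C1[OF smooth_mapD(2)[OF sm k m]] by blast
  from bspec[OF this xW] have H': "(?H has_derivative M ?x) (at ?x)" .
  have "\<exists>u. M ?x u = (0, wm, wp)"
  proof (rule diffeo_on_derivative_surj[OF _ _ diffeo k _ m \<Phi>_m])
    show "inj_on (snd c) (fst c)" if "c \<in> ?P" for c
      by (rule prod_chart_inj[OF _ TA.chart_inj that]) (auto simp: vec_atlas_def)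
    show "inj_on (snd c) (fst c)" if "c \<in> ?R" for c
      by (rule prod_chart_inj[OF _ prod_chart_inj[OF A.chart_inj A.chart_inj] that]) (auto simp: vec_atlas_def)
    show "(?H has_derivative M ?x) (at (snd ?k (h, v)))" using H' by simp
  qed (use hv in auto)
  then obtain u w where uw: "M ?x (u, w) = (0, wm, wp)" by auto
  have E2z: "?z \<in> E2" by (rule chart_in_E2[OF hv(3)])
  have "((\<lambda>p. fst (?H p)) has_derivative fst) (at ?x)"
  proof (rule has_derivative_transform_within_open[OF has_derivative_fst[OF has_derivative_ident]])
    show "open (UNIV \<times> E2)" by (intro open_Times E2_open) simp
    show "?x \<in> UNIV \<times> E2" using E2z by simp
    fix p :: "real \<times> 'e \<times> 'e" assume "p \<in> UNIV \<times> E2"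
    then obtain t z where p: "p = (t, z)" "z \<in> E2" by blast
    show "fst p = fst (?H p)" unfolding p(1) H_eq[OF p(2)] by simp
  qed
  from has_derivative_unique[OF this has_derivative_fst[OF H']] have "u = 0"
    using uw by (metis fst_conv)
  have G: "((\<lambda>z. (fst (G (\<alpha>m h) z), fst (G (\<alpha>p h) z))) has_derivative
      (\<lambda>w. (fst (G' (\<alpha>m h) ?z w), fst (G' (\<alpha>p h) ?z w)))) (at ?z)"
    by (intro has_derivative_Pair has_derivative_fst G_deriv D)
  have "((\<lambda>z. (h, z)) has_derivative (\<lambda>w. (0, w))) (at ?z)"
    by (intro has_derivative_Pair has_derivative_const has_derivative_ident)
  from has_derivative_snd[OF has_derivative_compose[OF this H']]
  have "((\<lambda>z. snd (?H (h, z))) has_derivative (\<lambda>w. snd (M ?x (0, w)))) (at ?z)" .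
  then have "((\<lambda>z. (fst (G (\<alpha>m h) z), fst (G (\<alpha>p h) z))) has_derivative (\<lambda>w. snd (M ?x (0, w)))) (at ?z)"
  proof (rule has_derivative_transform_within_open[OF _ E2_open E2z])
    fix x assume x: "x \<in> E2"
    show "snd (?H (h, x)) = (fst (G (\<alpha>m h) x), fst (G (\<alpha>p h) x))"
      unfolding H_eq[OF x] G_def by (simp add: fst_tangent_chart_apply)
  qed
  from fun_cong[OF has_derivative_unique[OF this G], of w] show ?thesis
    using uw \<open>u = 0\<close> by (intro exI[of _ w]) simp
qed

end

context chart_flow
begin

lemma V_locally_lipschitz:
  assumes z0: "z0 \<in> E2"
  shows "\<exists>K r. r > 0 \<and> K-lipschitz_on (ball z0 r) V"
proof -
  obtain V' where V': "\<forall>z\<in>E2. (V has_derivative blinfun_apply (V' z)) (at z)" and cont: "continuous_on E2 V'"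
    using V_C1 by (elim exE conjE)
  have "isCont V' z0" using cont z0 continuous_on_eq_continuous_at[OF E2_open] by blast
  then obtain r1 where r1: "r1 > 0" "\<And>z. dist z z0 < r1 \<Longrightarrow> dist (V' z) (V' z0) < 1"
    unfolding continuous_at_eps_delta using zero_less_one by blast
  obtain r2 where r2: "r2 > 0" "ball z0 r2 \<subseteq> E2" using E2_open z0 by (meson open_contains_ball)
  let ?r = "min r1 r2"
  have "(norm (V' z0) + 1)-lipschitz_on (ball z0 ?r) V"
  proof (rule bounded_derivative_imp_lipschitz)
    fix z assume z: "z \<in> ball z0 ?r"
    have "z \<in> E2" using z r2(2) by auto
    from bspec[OF V' this] show "(V has_derivative V' z) (at z within ball z0 ?r)"
      by (rule has_derivative_at_withinI)
    have "dist (V' z) (V' z0) < 1" using z by (intro r1) (simp add: dist_commute)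
    then have "norm (V' z) \<le> norm (V' z0) + 1" using norm_triangle_sub[of "V' z" "V' z0"] by (simp add: dist_norm)
    then show "onorm (blinfun_apply (V' z)) \<le> norm (V' z0) + 1" by (simp add: norm_blinfun.rep_eq)
  qed auto
  moreover have "?r > 0" using r1 r2 by simp
  ultimately show ?thesis by blast
qed

lemma flow_box_exists:
  assumes \<Omega>: "open \<Omega>" "\<Omega> \<subseteq> E2" "z0 \<in> \<Omega>" and W: "open W" "(0, z0) \<in> W"
  shows "\<exists>\<epsilon>>0. \<forall>t z. \<bar>t\<bar> < \<epsilon> \<longrightarrow> z \<in> ball z0 \<epsilon> \<longrightarrow> (t, z) \<in> D \<and> G t z \<in> \<Omega> \<and> (t, z) \<in> W"
proof -
  let ?S = "D \<inter> (\<lambda>(t, z). G t z) -` \<Omega> \<inter> W"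
  have z0: "z0 \<in> E2" using \<Omega> by blast
  have "open ?S" by (intro open_Int continuous_open_preimage G_cont D_open \<Omega> W)
  moreover have "(0, z0) \<in> ?S" using zero_in_D[OF z0] G_0[OF z0] \<Omega> W by simp
  ultimately obtain P R where PR: "open P" "open R" "(0, z0) \<in> P \<times> R" "P \<times> R \<subseteq> ?S" by (rule open_prod_elim)
  obtain r1 where r1: "r1 > 0" "ball 0 r1 \<subseteq> P" using PR open_contains_ball by (metis mem_Sigma_iff)
  obtain r2 where r2: "r2 > 0" "ball z0 r2 \<subseteq> R" using PR open_contains_ball by (metis mem_Sigma_iff)
  show ?thesis
  proof (intro exI[of _ "min r1 r2"] conjI allI impI)
    fix t z assume "\<bar>t\<bar> < min r1 r2" "z \<in> ball z0 (min r1 r2)"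
    then have "t \<in> ball 0 r1" "z \<in> ball z0 r2" by auto
    then have "(t, z) \<in> ?S" using r1 r2 PR(4) by blast
    then show "(t, z) \<in> D" "G t z \<in> \<Omega>" "(t, z) \<in> W" by auto
  qed (use r1 r2 in auto)
qed

text \<open>
  The box keeps the segment of the flow line between the times \<open>a\<close> and \<open>b\<close> in the chart, so that the discrete
  Lagrangian has the action integral as its representative.
\<close>

lemma action_coord:
  assumes box: "lagrangian_flow_box I B \<Omega> G G' V l l' \<phi>" and D: "I \<times> B \<subseteq> D"
    and ab: "a \<in> I" "b \<in> I" and v: "v \<in> fst Tc" "snd Tc v \<in> B"
  shows "tangent_map TA vec_atlas (\<lambda>v. LBINT t=ereal a..ereal b. L (F t v)) v w =
    (LBINT t=ereal a..ereal b. l' (G t (snd Tc v)) (G' t (snd Tc v) (tangent_coord TA Tc v w)))"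
proof -
  interpret lagrangian_flow_box I B \<Omega> G G' V l l' \<phi> by fact
  let ?act = "\<lambda>v. LBINT t=ereal a..ereal b. L (F t v)"
  have act: "(LBINT t=ereal a..ereal b. l (G t z)) = ?act (\<psi> z)" if "z \<in> B" for z
  proof (rule interval_integral_cong)
    fix t assume "t \<in> einterval (min (ereal a) (ereal b)) (max (ereal a) (ereal b))"
    then have "t \<in> {min a b..max a b}" by (auto simp: einterval_def min_def max_def split: if_splits)
    then have "(t, z) \<in> D" using Icc_subset[OF ab] D that by blast
    then show "l (G t z) = L (F t (\<psi> z))" using D_E2(5)[of t z] by (simp add: l_def)
  qed
  have "tangent_coord vec_atlas (UNIV, \<lambda>x. x) (?act v) (tangent_map TA vec_atlas ?act v w) =
    (\<lambda>d. LBINT t=ereal a..ereal b. l' (G t (snd Tc v)) (G' t (snd Tc v) d)) (tangent_coord TA Tc v w)"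
  proof (rule tangent_map_coord[OF TA.differentiable_atlas_axioms differentiable_atlas_vec Tc_in v(1) vec_chart_in _ B(1) v(2)])
    show "((\<lambda>x. snd (UNIV, \<lambda>x. x) (?act (\<psi> x))) has_derivative
        (\<lambda>d. LBINT t=ereal a..ereal b. l' (G t (snd Tc v)) (G' t (snd Tc v) d))) (at (snd Tc v))"
      using has_derivative_transform_within_open[OF action_derivative[OF ab v(2)] B(1) v(2) act] by simp
  qed simp_all
  then show ?thesis by simp
qed

end

text \<open>
  For \<open>h > 0\<close> the sign conditions give \<open>\<alpha>m h \<le> 0 \<le> \<alpha>p h\<close>, and the difference is \<open>h\<close>; the case
  \<open>h < 0\<close> is symmetric.  At \<open>h = 0\<close> the sign conditions say nothing.
\<close>

lemma discretization_pair_bounds: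
  assumes "discretization_pair a0 \<alpha>p \<alpha>m" "\<bar>h\<bar> < a0" "h \<noteq> 0"
  shows "\<bar>\<alpha>m h\<bar> \<le> \<bar>h\<bar>" "\<bar>\<alpha>p h\<bar> \<le> \<bar>h\<bar>" "\<alpha>p h - \<alpha>m h = h"
proof -
  have *: "h * \<alpha>p h \<ge> 0" "h * \<alpha>m h \<le> 0" "\<alpha>p h - \<alpha>m h = h"
    using assms by (auto simp: discretization_pair_def dest!: bspec[of _ _ h])
  consider "h > 0" | "h < 0" using assms(3) by linarith
  then have "\<bar>\<alpha>m h\<bar> \<le> \<bar>h\<bar> \<and> \<bar>\<alpha>p h\<bar> \<le> \<bar>h\<bar>"
  proof cases
    case 1 then show ?thesis using * by (auto simp: zero_le_mult_iff mult_le_0_iff)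
  next
    case 2 then show ?thesis using * by (auto simp: zero_le_mult_iff mult_le_0_iff)
  qed
  with * show "\<bar>\<alpha>m h\<bar> \<le> \<bar>h\<bar>" "\<bar>\<alpha>p h\<bar> \<le> \<bar>h\<bar>" "\<alpha>p h - \<alpha>m h = h" by auto
qed

section \<open>Flow steps and discrete trajectories\<close>

lemma all_surj_iff:
  assumes "surj g" "surj g'"
  shows "(\<forall>w w'. P (g w) (g' w')) \<longleftrightarrow> (\<forall>d d'. P d d')"
  using assms by (metis surjD)

lemma (in differentiable_atlas) chart_mem_image_iff:
  "c \<in> A \<Longrightarrow> p \<in> fst c \<Longrightarrow> snd c p \<in> snd c ` (S \<inter> fst c) \<longleftrightarrow> p \<in> S"
  using inj_on_image_mem_iff[OF chart_inj, of c p "S \<inter> fst c"] by simp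

text \<open>
  The transfer of \<open>flow_step_iff_critical\<close> to the manifold.  The box around \<open>v\<^sub>0\<close> is chosen such that the
  flow stays where the Legendre transform is injective, where the field is Lipschitz, and over \<open>Q0\<close>, and such that it
  lies in \<open>UE\<close>; membership in the discrete tangent bundle is then automatic.
\<close>

lemma (in chart_flow) local_equivalence:
  assumes Q0: "openin (manifold_topology A) Q0"
    and pair: "discretization_pair a0 \<alpha>p \<alpha>m"
    and adm: "admissible_domain A U F a0 \<alpha>p \<alpha>m UE"
    and v0: "v0 \<in> fst Tc" "fst v0 \<in> Q0"
  shows "\<exists>N. open N \<and> (0, snd Tc v0, snd Tc v0) \<in> N \<and>
    (\<forall>h v v'. v \<in> fst Tc \<longrightarrow> v' \<in> fst Tc \<longrightarrow> (h, snd Tc v, snd Tc v') \<in> N \<longrightarrow> h \<noteq> 0 \<longrightarrow>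
      ((h, v) \<in> U \<and> v' = F h v \<longleftrightarrow> exact_discrete_trajectory A L f F \<alpha>p \<alpha>m UE Q0 h v v'))"
proof -
  let ?z0 = "snd Tc v0"
  have z0: "?z0 \<in> E2" by (rule chart_in_E2[OF v0(1)])
  have "local_diffeo TA (cotangent_bundle A) (legendre L)" using regular by (simp add: regular_fms_def)
  then obtain S T where v0S: "v0 \<in> S" and S: "diffeo_on TA (cotangent_bundle A) S T (legendre L)"
    using in_points[OF v0(1)] unfolding local_diffeo_def by blast
  have inj: "inj_on (legendre L) S" and S_open: "openin (manifold_topology TA) S"
    using S by (auto simp: diffeo_on_def bij_betw_def)
  obtain K r where r: "r > 0" and lip: "K-lipschitz_on (ball ?z0 r) V" using V_locally_lipschitz[OF z0] by blast
  \<comment> \<open>\<open>\<Omega>\<close> collects what the flow must not leave: Legendre injectivity, base points in \<open>Q0\<close>, Lipschitz field.\<close>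
  define \<Omega> where "\<Omega> = snd Tc ` (S \<inter> fst Tc) \<inter> fst -` (snd c ` (Q0 \<inter> fst c)) \<inter> ball ?z0 r"
  have \<Omega>_open: "open \<Omega>"
    unfolding \<Omega>_def using S_open TA.openin_iff Tc_in Q0 A.openin_iff c_in
    by (intro open_Int open_vimage_fst open_ball) auto
  have \<Omega>_E2: "\<Omega> \<subseteq> E2" unfolding \<Omega>_def E2_def by auto
  have z0_\<Omega>: "?z0 \<in> \<Omega>"
    using v0 v0S r by (auto simp: \<Omega>_def fst_tangent_chart_apply fst_tangent_chart)
  have \<Omega>_S: "v \<in> S" if "v \<in> fst Tc" "snd Tc v \<in> \<Omega>" for v
    using that by (simp add: \<Omega>_def TA.chart_mem_image_iff[OF Tc_in])
  have \<Omega>_Q0: "fst v \<in> Q0" if "v \<in> fst Tc" "snd Tc v \<in> \<Omega>" for v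
  proof -
    have "snd c (fst v) \<in> snd c ` (Q0 \<inter> fst c)" "fst v \<in> fst c"
      using that by (auto simp: \<Omega>_def fst_tangent_chart_apply fst_tangent_chart)
    then show ?thesis using A.chart_mem_image_iff[OF c_in] by blast
  qed
  define W where "W = (\<lambda>(t, v). (t, snd Tc v)) ` (UE \<inter> UNIV \<times> fst Tc)"
  have UE: "openin (manifold_topology (prod_atlas vec_atlas TA)) UE" "UE \<subseteq> exact_bd_domain a0 \<alpha>p \<alpha>m U"
    "{0} \<times> points TA \<subseteq> UE" using adm by (auto simp: admissible_domain_def)
  have W_open: "open W" unfolding W_def by (rule TA.openin_vec_prod_imp_open[OF UE(1) Tc_in])
  have z0_W: "(0, ?z0) \<in> W" unfolding W_def using v0 UE(3) in_points[OF v0(1)] by (intro image_eqI[of _ _ "(0, v0)"]) auto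
  have W_UE: "(h, v) \<in> UE" if hv: "(h, snd Tc v) \<in> W" "v \<in> fst Tc" for h v
  proof -
    obtain p where p: "p \<in> UE \<inter> UNIV \<times> fst Tc" "(h, snd Tc v) = (\<lambda>(t, v). (t, snd Tc v)) p"
      using hv(1) unfolding W_def image_iff by blast
    obtain t u where tu: "p = (t, u)" by (cases p)
    have u: "(h, u) \<in> UE" "u \<in> fst Tc" "snd Tc v = snd Tc u" using p unfolding tu by simp_all
    with inj_onD[OF TA.chart_inj[OF Tc_in] u(3) hv(2) u(2)] show ?thesis by simp
  qed
  obtain \<epsilon> where \<epsilon>: "\<epsilon> > 0"
    and box: "\<forall>t z. \<bar>t\<bar> < \<epsilon> \<longrightarrow> z \<in> ball ?z0 \<epsilon> \<longrightarrow> (t, z) \<in> D \<and> G t z \<in> \<Omega> \<and> (t, z) \<in> W"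
    using flow_box_exists[OF \<Omega>_open \<Omega>_E2 z0_\<Omega> W_open z0_W] by (elim exE conjE)
  define I where "I = {-\<epsilon><..<\<epsilon>}"
  define B where "B = ball ?z0 \<epsilon>"
  have boxI: "(t, z) \<in> D" "G t z \<in> \<Omega>" "(t, z) \<in> W" if "t \<in> I" "z \<in> B" for t z
    using spec[OF spec[OF box, of t], of z] that by (auto simp: I_def B_def)
  have IB_D: "I \<times> B \<subseteq> D" using boxI by auto
  interpret regular_flow_box I B \<Omega> G G' V l l' \<phi> K
  proof unfold_locales
    show "open I" "is_interval I" "open B" "convex B" "0 \<in> I"
      using \<epsilon> by (auto simp: I_def B_def is_interval_oo)
    show "continuous_on (I \<times> B) (\<lambda>(t, z). G t z)" "continuous_on (I \<times> B) (\<lambda>(t, z). G' t z)"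
      by (rule continuous_on_subset[OF G_cont IB_D], rule continuous_on_subset[OF G'_cont IB_D])
    show "continuous_on \<Omega> l'" "continuous_on \<Omega> \<phi>"
      by (rule continuous_on_subset[OF l'_cont \<Omega>_E2], rule continuous_on_subset[OF \<phi>_cont \<Omega>_E2])
    show "K-lipschitz_on \<Omega> V" by (rule lipschitz_on_subset[OF lip]) (auto simp: \<Omega>_def)
    fix t z e assume tz: "t \<in> I" "z \<in> B"
    show "G t z \<in> \<Omega>" by (rule boxI[OF tz])
    show "(G t has_derivative G' t z) (at z)" by (rule G_deriv[OF boxI(1)[OF tz]])
    show "((\<lambda>t. G t z) has_vector_derivative V (G t z)) (at t)" by (rule G_time_deriv[OF boxI(1)[OF tz]])
    show "((\<lambda>s. l' (G s z) (0, e)) has_real_derivative l' (G t z) (e, 0) + \<phi> (G t z) (e, 0)) (at t)"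
      by (rule euler_lagrange[OF boxI(1)[OF tz]])
  next
    fix z assume "z \<in> B"
    then have "(0, z) \<in> D" using IB_D \<epsilon> by (auto simp: I_def)
    then show "G 0 z = z" by (intro G_0 D_E2(1))
  next
    fix z e assume "z \<in> \<Omega>"
    then have z: "z \<in> E2" using \<Omega>_E2 by blast
    show "fst (V z) = snd z" "(l has_derivative l' z) (at z)" "\<phi> z (0, e) = 0"
      by (rule V_second_order[OF z], rule l_deriv[OF z], rule \<phi>_horizontal[OF z])
  next
    fix z z' assume z: "z \<in> \<Omega>" "z' \<in> \<Omega>" and eq: "fst z = fst z'" "\<And>e. l' z (0, e) = l' z' (0, e)"
    have zE: "z \<in> E2" "z' \<in> E2" using z \<Omega>_E2 by auto
    note v = \<psi>_in[OF zE(1)] \<psi>_in[OF zE(2)] chart_\<psi>[OF zE(1)] chart_\<psi>[OF zE(2)]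
    have "legendre L (\<psi> z) = legendre L (\<psi> z')"
      by (rule legendre_eqI[OF v(1,2)]) (simp_all only: v eq)
    moreover have "\<psi> z \<in> S" "\<psi> z' \<in> S"
      by (rule \<Omega>_S[OF v(1)], simp only: v z, rule \<Omega>_S[OF v(2)], simp only: v z)
    ultimately have "\<psi> z = \<psi> z'" by (rule inj_onD[OF inj])
    then show "z = z'" using v by metis
  qed
  have "K \<ge> 0" using lip by (rule lipschitz_on_nonneg)
  have B_E2: "B \<subseteq> E2" using IB_D \<epsilon> D_E2(1) by (intro subsetI) (rule D_E2(1)[of 0], use IB_D \<epsilon> in \<open>auto simp: I_def\<close>)
  have z0_B: "?z0 \<in> B" using \<epsilon> by (simp add: B_def)
  obtain \<epsilon>' where \<epsilon>': "\<epsilon>' > 0" and box': "\<forall>t z. \<bar>t\<bar> < \<epsilon>' \<longrightarrow> z \<in> ball ?z0 \<epsilon>' \<longrightarrow> (t, z) \<in> D \<and> G t z \<in> B \<and> (t, z) \<in> UNIV"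
    using flow_box_exists[OF B(1) B_E2 z0_B open_UNIV UNIV_I] by (elim exE conjE)
  have stay: "G t z \<in> B" if "\<bar>t\<bar> < \<epsilon>'" "z \<in> ball ?z0 \<epsilon>'" for t z
    using box' that by blast
  \<comment> \<open>\<open>flow_add\<close> evaluates the flow at times up to \<open>2 * \<rho>\<close>, at points that the flow has moved for a time up to \<open>\<rho>\<close>.\<close>
  define \<rho> where "\<rho> = min (min (\<epsilon> / 3) (\<epsilon>' / 2)) (1 / (2 * (K + 1)))"
  have \<rho>: "\<rho> > 0" "2 * \<rho> < \<epsilon>" "\<rho> < \<epsilon>'" using \<epsilon> \<epsilon>' \<open>K \<ge> 0\<close> by (auto simp: \<rho>_def)
  have K\<rho>: "K * \<rho> < 1"
  proof -
    have "K * \<rho> \<le> K * (1 / (2 * (K + 1)))" using \<open>K \<ge> 0\<close> by (intro mult_left_mono) (auto simp: \<rho>_def)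
    also have "\<dots> < 1" using \<open>K \<ge> 0\<close> by (simp add: field_simps)
    finally show ?thesis .
  qed
  have \<rho>I: "{-2 * \<rho>..2 * \<rho>} \<subseteq> I" using \<rho> by (auto simp: I_def)
  let ?B = "ball ?z0 (min \<epsilon> \<epsilon>')"
  have "((h, v) \<in> U \<and> v' = F h v) \<longleftrightarrow> exact_discrete_trajectory A L f F \<alpha>p \<alpha>m UE Q0 h v v'"
    if v: "v \<in> fst Tc" "v' \<in> fst Tc" and hN: "(h, snd Tc v, snd Tc v') \<in> {-\<rho><..<\<rho>} \<times> ?B \<times> ?B" and h0: "h \<noteq> 0" for h v v'
  proof -
    define z where "z = snd Tc v"
    define z' where "z' = snd Tc v'"
    define a where "a = \<alpha>m h"
    define b where "b = \<alpha>p h"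
    have h: "\<bar>h\<bar> < \<rho>" using hN by auto
    have z: "z \<in> B" "z' \<in> B" "z \<in> ball ?z0 \<epsilon>'" "z' \<in> ball ?z0 \<epsilon>'" using hN by (auto simp: z_def z'_def B_def)
    have hI: "h \<in> I" using h \<rho> by (auto simp: I_def)
    have hUE: "(h, v) \<in> UE" "(h, v') \<in> UE"
      using W_UE boxI(3)[OF hI z(1)] boxI(3)[OF hI z(2)] v by (auto simp: z_def z'_def)
    have "\<bar>h\<bar> < a0" using hUE(1) UE(2) by (auto simp: exact_bd_domain_def)
    note bounds = discretization_pair_bounds[OF pair this h0]
    have ab: "\<bar>a\<bar> \<le> \<rho>" "\<bar>b\<bar> \<le> \<rho>" "\<bar>b - a\<bar> \<le> \<rho>" and h_ab: "h = b - a" using bounds h by (auto simp: a_def b_def)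
    have abI: "a \<in> I" "b \<in> I" using ab \<rho> by (auto simp: I_def)
    have D_v: "(t, snd Tc v) \<in> D" and D_v': "(t, snd Tc v') \<in> D" if "t \<in> I" for t
      using boxI(1)[OF that z(1)] boxI(1)[OF that z(2)] by (auto simp: z_def z'_def)
    have flow_in: "F t v \<in> fst Tc" "snd Tc (F t v) = G t z" "F t v' \<in> fst Tc" "snd Tc (F t v') = G t z'" if "t \<in> I" for t
      using D_E2(4)[OF D_v[OF that]] D_E2(4)[OF D_v'[OF that]] v by (auto simp: G_def z_def z'_def)
    have base_in: "fst (F t v) \<in> fst c" "fst (F t v') \<in> fst c" if "t \<in> I" for t
      using flow_in[OF that] by (auto simp: fst_tangent_chart)
    have Q0_in: "fst (F t v) \<in> Q0" "fst (F t v') \<in> Q0" if "t \<in> I" for t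
      using \<Omega>_Q0[OF flow_in(1)[OF that]] \<Omega>_Q0[OF flow_in(3)[OF that]] flow_in[OF that]
        boxI(2)[OF that z(1)] boxI(2)[OF that z(2)] by auto
    have bd: "exact_bd F \<alpha>m h = (\<lambda>v. fst (F a v))" "exact_bd F \<alpha>p h = (\<lambda>v. fst (F b v))"
      by (auto simp: fun_eq_iff exact_bd_def exact_psi_def a_def b_def)
    have in_V: "v \<in> exact_V F \<alpha>p \<alpha>m UE Q0 h" "v' \<in> exact_V F \<alpha>p \<alpha>m UE Q0 h"
      using hUE Q0_in abI by (auto simp: exact_V_def exact_bd_pair_def bd)
    let ?tc = "tangent_coord TA Tc v" and ?tc' = "tangent_coord TA Tc v'"
    have surj: "surj ?tc" "surj ?tc'" using TA.tangent_coord_bij[OF Tc_in v(1)] TA.tangent_coord_bij[OF Tc_in v(2)]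
      by (auto simp: bij_def)
    have base: "fst (F b v) = fst (F a v') \<longleftrightarrow> fst (G b z) = fst (G a z')"
      using flow_in[OF abI(1)] flow_in[OF abI(2)] base_in[OF abI(1)] base_in[OF abI(2)] inj_onD[OF A.chart_inj[OF c_in]]
      by (metis fst_tangent_chart_apply)
    have act: "tangent_map TA vec_atlas (exact_L L F \<alpha>p \<alpha>m h) v w =
        (LBINT t=ereal a..ereal b. l' (G t z) (G' t z (?tc w)))"
      "tangent_map TA vec_atlas (exact_L L F \<alpha>p \<alpha>m h) v' w =
        (LBINT t=ereal a..ereal b. l' (G t z') (G' t z' (?tc' w)))" for w
      using action_coord[OF lagrangian_flow_box_axioms IB_D abI v(1)] action_coord[OF lagrangian_flow_box_axioms IB_D abI v(2)] z
      by (simp_all add: exact_L_def[abs_def] z_def z'_def a_def b_def)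
    have in_I: "t \<in> I" if "t \<in> einterval (min (ereal a) (ereal b)) (max (ereal a) (ereal b))" for t
    proof -
      have "t \<in> {min a b..max a b}" using that by (auto simp: einterval_def min_def max_def split: if_splits)
      then show ?thesis using Icc_subset[OF abI] by blast
    qed
    have force: "exact_f A f F \<alpha>p \<alpha>m h v w = (LBINT t=ereal a..ereal b. \<phi> (G t z) (G' t z (?tc w)))"
      "exact_f A f F \<alpha>p \<alpha>m h v' w = (LBINT t=ereal a..ereal b. \<phi> (G t z') (G' t z' (?tc' w)))" for w
      unfolding exact_f_def a_def[symmetric] b_def[symmetric] z_def z'_def
      by (rule interval_integral_cong, rule force_coord[OF v(1) D_v[OF in_I]], assumption,
          rule interval_integral_cong, rule force_coord[OF v(2) D_v'[OF in_I]], assumption)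
    have bd_zero: "tangent_map TA A (\<lambda>v. fst (F a v)) v w = 0 \<longleftrightarrow> fst (G' a z (?tc w)) = 0"
      "tangent_map TA A (\<lambda>v. fst (F b v)) v' w = 0 \<longleftrightarrow> fst (G' b z' (?tc' w)) = 0" for w
      unfolding z_def z'_def base_map_coord[OF v(1) D_v[OF abI(1)], symmetric] base_map_coord[OF v(2) D_v'[OF abI(2)], symmetric]
      by (rule A.tangent_coord_eq_0_iff[OF c_in base_in(1)[OF abI(1)], symmetric],
          rule A.tangent_coord_eq_0_iff[OF c_in base_in(2)[OF abI(2)], symmetric])
    \<comment> \<open>Tangent vectors at the two boundary points can be compared only once the points coincide.\<close>
    have bd_eq: "tangent_map TA A (\<lambda>v. fst (F b v)) v w = tangent_map TA A (\<lambda>v. fst (F a v)) v' w' \<longleftrightarrow>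
        fst (G' b z (?tc w)) = fst (G' a z' (?tc' w'))" if eq: "fst (F b v) = fst (F a v')" for w w'
      unfolding z_def z'_def base_map_coord[OF v(1) D_v[OF abI(2)], symmetric] base_map_coord[OF v(2) D_v'[OF abI(1)], symmetric]
      unfolding eq[symmetric] by (rule A.tangent_coord_eq_iff[OF c_in base_in(1)[OF abI(2)], symmetric])
    let ?crit = "\<lambda>d d'. fst (G' a z d) = 0 \<and> fst (G' b z d) = fst (G' a z' d') \<and> fst (G' b z' d') = 0 \<longrightarrow>
      ((LBINT t=ereal a..ereal b. l' (G t z) (G' t z d)) + (LBINT t=ereal a..ereal b. \<phi> (G t z) (G' t z d))) +
      ((LBINT t=ereal a..ereal b. l' (G t z') (G' t z' d')) + (LBINT t=ereal a..ereal b. \<phi> (G t z') (G' t z' d'))) = 0"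
    have "exact_discrete_trajectory A L f F \<alpha>p \<alpha>m UE Q0 h v v' \<longleftrightarrow>
        fst (G b z) = fst (G a z') \<and> (\<forall>w w'. ?crit (?tc w) (?tc' w'))"
      unfolding exact_discrete_trajectory_def discrete_trajectory_def bd act force bd_zero base[symmetric]
      using in_V bd_eq by (simp cong: conj_cong)
    also have "(\<forall>w w'. ?crit (?tc w) (?tc' w')) \<longleftrightarrow> (\<forall>d d'. ?crit d d')"
      by (rule all_surj_iff[OF surj, of ?crit])
    also have "fst (G b z) = fst (G a z') \<and> (\<forall>d d'. ?crit d d') \<longleftrightarrow> z' = G (b - a) z"
    proof (rule flow_step_iff_critical[OF less_imp_le[OF \<rho>(1)] K\<rho> \<rho>I _ z(1,2) ab, symmetric])
      show "G t w \<in> B" if "\<bar>t\<bar> \<le> \<rho>" "w \<in> {z, z'}" for t w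
        using stay[of t w] that z \<rho> by auto
      show "\<exists>d. fst (G' a z d) = 0 \<and> fst (G' b z d) = e" for e
        unfolding a_def b_def z_def
        by (rule boundary_derivative_surj[OF adm hUE(1) h0 v(1) D_v[OF abI(1), unfolded a_def] D_v[OF abI(2), unfolded b_def]])
      show "\<exists>d. fst (G' a z' d) = e \<and> fst (G' b z' d) = 0" for e
        unfolding a_def b_def z'_def
        by (rule boundary_derivative_surj[OF adm hUE(2) h0 v(2) D_v'[OF abI(1), unfolded a_def] D_v'[OF abI(2), unfolded b_def]])
    qed
    also have "z' = G (b - a) z \<longleftrightarrow> snd Tc v' = snd Tc (F h v)"
      unfolding flow_in(2)[OF hI] h_ab[symmetric] z'_def ..
    also have "\<dots> \<longleftrightarrow> v' = F h v"
      by (rule inj_on_eq_iff[OF TA.chart_inj[OF Tc_in] v(2) flow_in(1)[OF hI]])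
    also have "\<dots> \<longleftrightarrow> (h, v) \<in> U \<and> v' = F h v"
      using D_E2(3)[OF D_v[OF hI]] v by simp
    finally show ?thesis by (rule sym)
  qed
  moreover have "open ({-\<rho><..<\<rho>} \<times> ?B \<times> ?B)" by (intro open_Times open_ball open_greaterThanLessThan)
  moreover have "(0, ?z0, ?z0) \<in> {-\<rho><..<\<rho>} \<times> ?B \<times> ?B" using \<rho> \<epsilon> \<epsilon>' by simp
  ultimately show ?thesis by blast
qed

theorem theorem3p38:
  fixes A :: "('q, 'e::banach) atlas"
    and L :: "'q \<times> 'e \<Rightarrow> real"
    and f :: "'q \<times> 'e \<Rightarrow> ('e \<times> 'e) \<Rightarrow>\<^sub>L real"
    and X :: "'q \<times> 'e \<Rightarrow> 'e \<times> 'e"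
    and U UE :: "(real \<times> 'q \<times> 'e) set"
    and F :: "real \<Rightarrow> 'q \<times> 'e \<Rightarrow> 'q \<times> 'e"
    and a0 a :: real
    and \<alpha>p \<alpha>m :: "real \<Rightarrow> real"
    and Q0 :: "'q set"
  assumes "regular_fms A L f"
    and "lagrangian_vector_field A L f X"
    and "is_flow (tangent_bundle A) X U F"
    and "openin (manifold_topology A) Q0"
    and "compactin (manifold_topology A) (manifold_topology A closure_of Q0)"
    and "discretization_pair a0 \<alpha>p \<alpha>m"
    and "admissible_domain A U F a0 \<alpha>p \<alpha>m UE"
    and "a > 0"
    and "{-a<..<a} \<times> {(q, q) | q. q \<in> Q0} \<subseteq> exact_bd_tilde F \<alpha>p \<alpha>m ` UE"
  shows "\<exists>Ut. openin (manifold_topology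
                 (prod_atlas vec_atlas (prod_atlas (tangent_bundle A) (tangent_bundle A)))) Ut \<and>
              {0} \<times> {(v, v) | v. v \<in> Q0 \<times> UNIV} \<subseteq> Ut \<and>
              (\<forall>(h, v, v') \<in> Ut. 0 \<noteq> h \<and> \<bar>h\<bar> < a \<longrightarrow>
                 ((h, v) \<in> U \<and> v' = F h v \<longleftrightarrow>
                  exact_discrete_trajectory A L f F \<alpha>p \<alpha>m UE Q0 h v v'))"
proof -
  let ?TA = "tangent_bundle A"
  have A: "smooth_manifold A" using assms(1) by (simp add: regular_fms_def forced_mechanical_system_def)
  interpret A: differentiable_atlas A using A by (rule smooth_manifold_imp_differentiable_atlas)
  interpret TA: differentiable_atlas ?TA using A by (rule differentiable_atlas_tangent_bundle)
  let ?P = "\<lambda>h v v'. (h, v) \<in> U \<and> v' = F h v \<longleftrightarrow> exact_discrete_trajectory A L f F \<alpha>p \<alpha>m UE Q0 h v v'"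
  let ?box = "\<lambda>(k :: ('q \<times> 'e, 'e \<times> 'e) chart) N. {(h::real, v, v'). v \<in> fst k \<and> v' \<in> fst k \<and> (h, snd k v, snd k v') \<in> N}"
  define \<B> where "\<B> = {?box k N | k N. k \<in> ?TA \<and> open N \<and> (\<forall>(h, v, v') \<in> ?box k N. h \<noteq> 0 \<longrightarrow> ?P h v v')}"
  show ?thesis
  proof (intro exI[of _ "\<Union>\<B>"] conjI)
    show "openin (manifold_topology (prod_atlas vec_atlas (prod_atlas ?TA ?TA))) (\<Union>\<B>)"
    proof (rule openin_Union)
      fix W assume "W \<in> \<B>"
      then obtain k N where "W = ?box k N" "k \<in> ?TA" "open N" unfolding \<B>_def by blast
      then show "openin (manifold_topology (prod_atlas vec_atlas (prod_atlas ?TA ?TA))) W"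
        using TA.openin_pair_box by simp
    qed
    show "{0} \<times> {(v, v) | v. v \<in> Q0 \<times> UNIV} \<subseteq> \<Union>\<B>"
    proof clarsimp
      fix q e assume q: "q \<in> Q0"
      have "q \<in> points A" using subsetD[OF conjunct1[OF iffD1[OF A.openin_iff assms(4)]] q] .
      define c where "c = chart_at A q"
      have c: "c \<in> A" "q \<in> fst c" unfolding c_def by (rule chart_at_in[OF \<open>q \<in> points A\<close>])+
      interpret chart_flow A L f X U F c by (rule chart_flow.intro[OF assms(1-3) c(1)])
      have qe: "(q, e) \<in> fst Tc" "fst (q, e) \<in> Q0" using c q by (auto simp: fst_tangent_chart)
      obtain N where N: "open N" "(0, snd Tc (q, e), snd Tc (q, e)) \<in> N"
        "\<forall>h v v'. v \<in> fst Tc \<longrightarrow> v' \<in> fst Tc \<longrightarrow> (h, snd Tc v, snd Tc v') \<in> N \<longrightarrow> h \<noteq> 0 \<longrightarrow> ?P h v v'"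
        using local_equivalence[OF assms(4,6,7) qe] by (elim exE conjE)
      have 1: "?box Tc N \<in> \<B>" unfolding \<B>_def using Tc_in N by blast
      have 2: "(0, (q, e), (q, e)) \<in> ?box Tc N" using N(2) c by (simp add: fst_tangent_chart)
      show "\<exists>x\<in>\<B>. (0, (q, e), q, e) \<in> x" using 2 1 by (rule bexI)
    qed
    show "\<forall>(h, v, v') \<in> \<Union>\<B>. 0 \<noteq> h \<and> \<bar>h\<bar> < a \<longrightarrow> ?P h v v'"
    proof
      fix p assume "p \<in> \<Union>\<B>"
      then obtain k N where p: "p \<in> ?box k N" and good: "\<forall>(h, v, v') \<in> ?box k N. h \<noteq> 0 \<longrightarrow> ?P h v v'"
        unfolding \<B>_def by blast
      from bspec[OF good p] show "case p of (h, v, v') \<Rightarrow> 0 \<noteq> h \<and> \<bar>h\<bar> < a \<longrightarrow> ?P h v v'"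
        by (cases p) auto
    qed
  qed
qed

end
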